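(* Let $u=2\partial_{x_1}^2F(\Theta)$ be a smooth solution of the Zakharov--Kuznetsov equation $$-4\partial_tu+\partial_{x_1}(\Delta u+3u^2)=0,\qquad u=u(t,x),\ t\in\mathbb R,\ x=(x_1,x')\in\mathbb R\times\mathbb R^{d-1},$$ with $\Theta>0$ and with $F(1)=0$, $F'(1)=1$, $F''(1)=-1$, $F'''(1)=2$. Then $u=Q_k$ for some $k>0$ (the KdV soliton, $Q_k(t,x)=2k^2\operatorname{sech}^2(kx_1+k^3t)$) and $F=\log$ if and only if $$Ai(\Theta)=W_1(\Theta)=W^F_{x_j}(\Theta)=0,\qquad j=2,\dots,d,$$ where $$W_1(\Theta):=(\partial_{x_1}^2\Theta)^2-\partial_{x_1}\Theta\,\partial_{x_1}^3\Theta,\qquad W^F_{x_j}(\Theta):=\partial_{x_j}^2\Theta-F'(\Theta)(\partial_{x_j}\Theta)^2.$$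
   Context: $F$ (profile) and $\Theta=\Theta(t,x)$ (phase) are smooth real-valued functions, $F$ being defined on the range of $\Theta$ (the convention is $F:[1,\infty)\to\mathbb R$, $\Theta\in[1,\infty)$, without loss of generality). $\Delta$ is the Laplacian in $x\in\mathbb R^d$. In this KdV-type setting $Ai(\Theta):=-4\Theta_t+\partial_{x_1}^3\Theta$. For $u$ of the given form, the equation is used integrated once in $x_1$. All identities hold for all $(t,x)$.
   Formalization: Q_k is taken up to translation in x_1; the soliton side also requires Θ→1 as x_1→−∞ or x_1→+∞ (else Θ=cosh(kx_1+k^3t), F=log is a counterexample); the range of Θ is assumed to have closure [1,∞) (else constant Θ=1 is a counterexample). *)

theory Defs
  imports "HOL-Analysis.Analysis"
begin

text \<open>Space-time points are pairs \<open>(t, x)\<close> in \<open>real \<times> real^'n\<close>, so that \<open>d = CARD('n)\<close>. The index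
  playing the role of the first spatial coordinate is an arbitrary parameter \<open>i :: 'n\<close>; the
  transversal coordinates (numbered \<open>2, \<dots>, d\<close> on paper) are the indices different from \<open>i\<close>.\<close>

definition partial :: "'a::real_normed_vector \<Rightarrow> ('a \<Rightarrow> real) \<Rightarrow> 'a \<Rightarrow> real" where
  "partial v f p = deriv (\<lambda>s. f (p + s *\<^sub>R v)) 0"

text \<open>\<open>C\<^sup>\<infinity>\<close>: all iterated directional derivatives are Frechet differentiable everywhere (hence
  also continuous).\<close>

definition smooth :: "('a::real_normed_vector \<Rightarrow> real) \<Rightarrow> bool" where
  "smooth f \<longleftrightarrow> (\<forall>vs. (foldr partial vs f) differentiable_on UNIV)"

definition D_t :: "(real \<times> (real^'n::finite) \<Rightarrow> real) \<Rightarrow> real \<times> (real^'n) \<Rightarrow> real" where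
  "D_t = partial (1, 0)"

definition D_x :: "'n::finite \<Rightarrow> (real \<times> (real^'n) \<Rightarrow> real) \<Rightarrow> real \<times> (real^'n) \<Rightarrow> real" where
  "D_x j = partial (0, axis j 1)"

definition laplacian :: "(real \<times> (real^'n) \<Rightarrow> real) \<Rightarrow> real \<times> (real^'n) \<Rightarrow> real" where
  "laplacian f p = (\<Sum>j\<in>UNIV. D_x j (D_x j f) p)"

definition ZK_solution :: "'n::finite \<Rightarrow> (real \<times> (real^'n) \<Rightarrow> real) \<Rightarrow> bool" where
  "ZK_solution i u \<longleftrightarrow>
     (\<forall>p. - 4 * D_t u p + D_x i (\<lambda>q. laplacian u q + 3 * (u q)\<^sup>2) p = 0)"

text \<open>A profile is a function on \<open>[1, \<infinity>)\<close>, represented by a total function whose values below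
  \<open>1\<close> are irrelevant. Its derivatives are taken within \<open>[1, \<infinity>)\<close>, hence one-sided at \<open>1\<close>.\<close>

definition profile_deriv :: "nat \<Rightarrow> (real \<Rightarrow> real) \<Rightarrow> real \<Rightarrow> real" where
  "profile_deriv n F = ((\<lambda>g y. vector_derivative g (at y within {1..})) ^^ n) F"

definition smooth_profile :: "(real \<Rightarrow> real) \<Rightarrow> bool" where
  "smooth_profile F \<longleftrightarrow> (\<forall>n. (profile_deriv n F) differentiable_on {1..})"

definition Ai :: "'n::finite \<Rightarrow> (real \<times> (real^'n) \<Rightarrow> real) \<Rightarrow> real \<times> (real^'n) \<Rightarrow> real" where
  "Ai i \<Theta> p = - 4 * D_t \<Theta> p + D_x i (D_x i (D_x i \<Theta>)) p"

definition W1 :: "'n::finite \<Rightarrow> (real \<times> (real^'n) \<Rightarrow> real) \<Rightarrow> real \<times> (real^'n) \<Rightarrow> real" where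
  "W1 i \<Theta> p = (D_x i (D_x i \<Theta>) p)\<^sup>2 - D_x i \<Theta> p * D_x i (D_x i (D_x i \<Theta>)) p"

definition WF :: "(real \<Rightarrow> real) \<Rightarrow> 'n \<Rightarrow> (real \<times> (real^'n) \<Rightarrow> real) \<Rightarrow> real \<times> (real^'n) \<Rightarrow> real" where
  "WF F j \<Theta> p = D_x j (D_x j \<Theta>) p - profile_deriv 1 F (\<Theta> p) * (D_x j \<Theta> p)\<^sup>2"

definition Q :: "'n::finite \<Rightarrow> real \<Rightarrow> real \<times> (real^'n) \<Rightarrow> real" where
  "Q i k = (\<lambda>(t, x). 2 * k\<^sup>2 * (1 / cosh (k * x $ i + k ^ 3 * t))\<^sup>2)"

text \<open>The phase of a given solution is not unique: for the logarithmic profile, multiplying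
  \<open>\<Theta>\<close> by \<open>exp (a x\<^sub>1 + b)\<close>, with \<open>a\<close> and \<open>b\<close> independent of \<open>x\<^sub>1\<close>, does not change \<open>u\<close>. The
  following condition fixes this factor: \<open>\<Theta>\<close> tends to the lower endpoint of \<open>[1, \<infinity>)\<close> at one
  of the two ends of the \<open>x\<^sub>1\<close>-axis, as for \<open>1 + exp (2 (k x\<^sub>1 + k\<^sup>3 t))\<close> and its reflection.\<close>

definition normalised_phase :: "'n::finite \<Rightarrow> (real \<times> (real^'n) \<Rightarrow> real) \<Rightarrow> bool" where
  "normalised_phase i \<Theta> \<longleftrightarrow>
     (\<forall>t x. ((\<lambda>s. \<Theta> (t, x + s *\<^sub>R axis i 1)) \<longlongrightarrow> 1) at_bot) \<or>
     (\<forall>t x. ((\<lambda>s. \<Theta> (t, x + s *\<^sub>R axis i 1)) \<longlongrightarrow> 1) at_top)"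

end

theory Submission imports Defs begin

text \<open>The equivalence holds because both sides say the same thing about the phase: it is
\<open>\<Theta> = 1 + exp (a x\<^sub>1 + (a\<^sup>3 / 4) t + c)\<close> for some \<open>a \<noteq> 0\<close>. With \<open>F = ln\<close> such a phase produces the
soliton with \<open>k = \<bar>a\<bar> / 2\<close>, and a direct computation shows that it annihilates \<open>Ai\<close>, \<open>W\<^sub>1\<close> and
the transversal Wronskians (\<open>exp_phase_conditions\<close>).

From the soliton to the conditions. The logarithms of \<open>\<Theta>\<close> and of the standard phase
\<open>1 + exp \<xi>\<close> have the same second \<open>x\<^sub>1\<close>-derivative, so they differ by an affine function of \<open>x\<^sub>1\<close>. The
normalisation at one end of the \<open>x\<^sub>1\<close>-axis forces this affine function to be \<open>0\<close> or \<open>- \<xi>\<close>, which gives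
\<open>\<Theta> = 1 + exp (\<plusminus> \<xi>)\<close> (\<open>normalised_soliton_phase\<close>).

From the conditions to the soliton, there are three steps.

\<^item> Along a transversal axis, \<open>W\<^sup>F = 0\<close> says that \<open>exp (- F(\<Theta>))\<close> times the derivative of \<open>\<Theta>\<close> is
  constant. If this constant were nonzero, \<open>\<Theta>\<close> would decrease at least linearly in one direction as long
  as it stays in a bounded part of \<open>[1, \<infinity>)\<close>, and so leave \<open>[1, \<infinity>)\<close>. Hence \<open>\<Theta>\<close> depends only on
  \<open>t\<close> and \<open>x\<^sub>1\<close> (\<open>transversal_independence\<close>).

\<^item> Where \<open>g = \<partial>\<^sub>1 \<Theta>\<close> does not vanish, \<open>W\<^sub>1 = 0\<close> says that the logarithmic derivative
  \<open>\<partial>\<^sub>1 g / g\<close> is independent of \<open>x\<^sub>1\<close>, and \<open>Ai = 0\<close> then makes it independent of \<open>t\<close>. So \<open>g\<close> is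
  locally an exponential; since an exponential never approaches zero at a finite point, a connectedness
  argument makes this global (\<open>exp_phase_if_Ai_W1_zero\<close>). The
  additive constant in \<open>\<Theta>\<close> is \<open>1\<close> because the range of \<open>\<Theta>\<close> is dense in \<open>[1, \<infinity>)\<close>.

\<^item> With this phase, the equation becomes an ordinary differential equation for
  \<open>s \<mapsto> F (1 + exp s)\<close>. The data of \<open>F\<close> at \<open>1\<close> describe its behaviour as \<open>s \<rightarrow> -\<infinity>\<close>, and first
  integrals reduce the equation to the logistic equation, whose solution is that of \<open>F = ln\<close>
  (\<open>travelling_wave_unique\<close>, \<open>profile_log_if_exp_phase\<close>).\<close>

section \<open>Directional derivatives of smooth functions\<close>

lemma has_derivative_along_line:
  fixes f :: "'a::real_normed_vector \<Rightarrow> real"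
  assumes "(f has_derivative f') (at (p + s *\<^sub>R v))"
  shows "((\<lambda>r. f (p + r *\<^sub>R v)) has_real_derivative f' v) (at s)"
proof -
  interpret f': bounded_linear f' using assms by (rule has_derivative_bounded_linear)
  have "((\<lambda>r. p + r *\<^sub>R v) has_derivative (\<lambda>r. r *\<^sub>R v)) (at s)"
    by (auto intro!: derivative_eq_intros)
  from has_derivative_compose[OF this assms] show ?thesis
    by (simp add: has_field_derivative_def f'.scaleR mult.commute[of _ "f' v"])
qed

lemma partial_eq:
  "((\<lambda>s. f (p + s *\<^sub>R v)) has_real_derivative d) (at 0) \<Longrightarrow> partial v f p = d"
  unfolding partial_def by (rule DERIV_imp_deriv)

lemma partial_eq_has_derivative:
  "(f has_derivative f') (at p) \<Longrightarrow> partial v f p = f' v"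
  using has_derivative_along_line[of f f' p 0 v] by (auto intro: partial_eq)

lemma smooth_partial: "smooth f \<Longrightarrow> smooth (partial v f)"
proof -
  assume f: "smooth f"
  have "foldr partial vs (partial v f) = foldr partial (vs @ [v]) f" for vs by simp
  with f show ?thesis unfolding smooth_def by metis
qed

lemma smooth_differentiable: "smooth f \<Longrightarrow> f differentiable (at p)"
  unfolding smooth_def differentiable_on_def by (metis UNIV_I foldr.simps(1) id_apply)

lemma smooth_isCont: "smooth f \<Longrightarrow> isCont f p"
  by (metis smooth_differentiable differentiable_imp_continuous_within)

lemma smooth_line_deriv:
  assumes "smooth f"
  shows "((\<lambda>s. f (p + s *\<^sub>R v)) has_real_derivative partial v f (p + s *\<^sub>R v)) (at s)"
proof -
  obtain f' where f': "(f has_derivative f') (at (p + s *\<^sub>R v))"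
    using smooth_differentiable[OF assms] unfolding differentiable_def by blast
  show ?thesis
    using has_derivative_along_line[OF f'] partial_eq_has_derivative[OF f'] by simp
qed

lemma smooth_line_deriv0:
  assumes "smooth f"
  shows "((\<lambda>s. f (p + s *\<^sub>R v)) has_real_derivative partial v f p) (at 0)"
  using smooth_line_deriv[OF assms, of p v 0] by simp

text \<open>The mean value theorem in direction \<open>v\<close>, applied to the difference in direction \<open>w\<close>, and then again in
direction \<open>w\<close>. The left-hand side is symmetric in \<open>v\<close> and \<open>w\<close>, which is what makes mixed derivatives
commute.\<close>

lemma second_difference_MVT:
  fixes f :: "'a::real_normed_vector \<Rightarrow> real"
  assumes f: "smooth f" and h: "0 < h"
  shows "\<exists>r s. 0 < r \<and> r < h \<and> 0 < s \<and> s < h \<and>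
    f (p + h *\<^sub>R v + h *\<^sub>R w) - f (p + h *\<^sub>R v) - f (p + h *\<^sub>R w) + f p
      = h * h * partial w (partial v f) (p + r *\<^sub>R v + s *\<^sub>R w)"
proof -
  have "((\<lambda>r. f ((p + h *\<^sub>R w) + r *\<^sub>R v) - f (p + r *\<^sub>R v)) has_real_derivative
      partial v f ((p + h *\<^sub>R w) + r *\<^sub>R v) - partial v f (p + r *\<^sub>R v)) (at r)" for r
    by (intro DERIV_diff smooth_line_deriv f)
  from MVT2[OF h this] obtain r where r: "0 < r" "r < h"
    "f ((p + h *\<^sub>R w) + h *\<^sub>R v) - f (p + h *\<^sub>R v) - (f (p + h *\<^sub>R w) - f p) =
      h * (partial v f ((p + h *\<^sub>R w) + r *\<^sub>R v) - partial v f (p + r *\<^sub>R v))"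
    by auto
  from MVT2[OF h smooth_line_deriv[OF smooth_partial[OF f]]] obtain s where s: "0 < s" "s < h"
    "partial v f ((p + r *\<^sub>R v) + h *\<^sub>R w) - partial v f ((p + r *\<^sub>R v) + 0 *\<^sub>R w)
      = (h - 0) * partial w (partial v f) ((p + r *\<^sub>R v) + s *\<^sub>R w)"
    by blast
  have "f (p + h *\<^sub>R v + h *\<^sub>R w) - f (p + h *\<^sub>R v) - f (p + h *\<^sub>R w) + f p
      = h * h * partial w (partial v f) (p + r *\<^sub>R v + s *\<^sub>R w)"
    using r(3) s(3) by (simp add: algebra_simps)
  with r s show ?thesis by blast
qed

text \<open>Schwarz's theorem. The second difference over a small parallelogram at \<open>p\<close> equals both mixed derivatives
at nearby points, up to the common factor \<open>h\<^sup>2\<close>; two continuous functions that share values arbitrarily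
close to \<open>p\<close> agree at \<open>p\<close>.\<close>

lemma partial_commute:
  assumes f: "smooth f"
  shows "partial v (partial w f) p = partial w (partial v f) p"
proof (rule ccontr)
  let ?A = "partial w (partial v f)" and ?B = "partial v (partial w f)"
  define e where "e = \<bar>?A p - ?B p\<bar> / 2"
  assume "?B p \<noteq> ?A p"
  then have e: "e > 0" by (simp add: e_def)
  have "isCont ?A p" "isCont ?B p" by (auto intro!: smooth_isCont smooth_partial f)
  then obtain d1 d2 where d: "d1 > 0" "d2 > 0"
    "\<And>q. dist q p < d1 \<Longrightarrow> dist (?A q) (?A p) < e" "\<And>q. dist q p < d2 \<Longrightarrow> dist (?B q) (?B p) < e"
    unfolding continuous_at_eps_delta using e by metis
  define D where "D = min d1 d2"
  \<comment> \<open>With this side length every point of the parallelogram has distance less than \<open>D\<close> from \<open>p\<close>.\<close>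
  define h where "h = D / (2 * (norm v + norm w + 1))"
  have D: "D > 0" using d by (simp add: D_def)
  have pos: "norm v + norm w + 1 > 0" by (simp add: add_nonneg_pos)
  have h: "h > 0" using D pos by (simp add: h_def)
  have hD: "h * (norm v + norm w) < D"
  proof -
    have "h * (norm v + norm w) < h * (2 * (norm v + norm w + 1))"
      using h pos by (intro mult_strict_left_mono) auto
    also have "\<dots> = D" using pos by (simp add: h_def)
    finally show ?thesis .
  qed
  have near: "dist (p + r *\<^sub>R x + s *\<^sub>R y) p < D"
    if "0 < r" "r < h" "0 < s" "s < h" "norm x + norm y = norm v + norm w" for r s x y
  proof -
    have "dist (p + r *\<^sub>R x + s *\<^sub>R y) p \<le> r * norm x + s * norm y"
      using that norm_triangle_ineq[of "r *\<^sub>R x" "s *\<^sub>R y"] by (simp add: dist_norm algebra_simps)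
    also have "\<dots> \<le> h * norm x + h * norm y"
      using that by (intro add_mono mult_right_mono) auto
    also have "\<dots> < D" using hD that(5) by (metis distrib_left)
    finally show ?thesis .
  qed
  obtain r s where rs: "0 < r" "r < h" "0 < s" "s < h"
    "f (p + h *\<^sub>R v + h *\<^sub>R w) - f (p + h *\<^sub>R v) - f (p + h *\<^sub>R w) + f p
      = h * h * ?A (p + r *\<^sub>R v + s *\<^sub>R w)"
    using second_difference_MVT[OF f h] by metis
  obtain r' s' where rs': "0 < r'" "r' < h" "0 < s'" "s' < h"
    "f (p + h *\<^sub>R w + h *\<^sub>R v) - f (p + h *\<^sub>R w) - f (p + h *\<^sub>R v) + f p
      = h * h * ?B (p + r' *\<^sub>R w + s' *\<^sub>R v)"
    using second_difference_MVT[OF f h] by metis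
  have "f (p + h *\<^sub>R v + h *\<^sub>R w) = f (p + h *\<^sub>R w + h *\<^sub>R v)" by (simp add: add.commute add.left_commute)
  then have "h * h * ?A (p + r *\<^sub>R v + s *\<^sub>R w) = h * h * ?B (p + r' *\<^sub>R w + s' *\<^sub>R v)"
    using rs(5) rs'(5) by linarith
  then have AB: "?A (p + r *\<^sub>R v + s *\<^sub>R w) = ?B (p + r' *\<^sub>R w + s' *\<^sub>R v)"
    using h by simp
  have "dist (?A (p + r *\<^sub>R v + s *\<^sub>R w)) (?A p) < e"
    using near[OF rs(1-4)] by (intro d) (auto simp: D_def)
  moreover have "dist (?B (p + r' *\<^sub>R w + s' *\<^sub>R v)) (?B p) < e"
    using near[OF rs'(1-4), of w v] by (intro d) (auto simp: D_def)
  ultimately have "dist (?A p) (?B p) < e + e"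
    unfolding AB by (metis add_strict_mono dist_commute dist_triangle_lt le_less_trans dist_triangle)
  then show False by (simp add: e_def dist_real_def)
qed

lemma D_x_zero: "D_x j (\<lambda>_. 0) = (\<lambda>_. 0)"
  unfolding D_x_def by (rule ext, rule partial_eq) simp

lemma has_derivative_zero_if_partials_zero:
  fixes f :: "real \<times> (real^'n::finite) \<Rightarrow> real"
  assumes "f differentiable (at p)" and "D_t f p = 0" and "\<And>j. D_x j f p = 0"
  shows "(f has_derivative (\<lambda>_. 0)) (at p)"
proof -
  obtain f' where f': "(f has_derivative f') (at p)"
    using assms(1) unfolding differentiable_def by blast
  interpret f': bounded_linear f' using f' by (rule has_derivative_bounded_linear)
  have t: "f' (1, 0) = 0" and x: "\<And>j. f' (0, axis j 1) = 0"
    using assms(2,3) partial_eq_has_derivative[OF f'] by (auto simp: D_t_def D_x_def)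
  have "f' (s, y) = 0" for s y
  proof -
    have "(s, y) = s *\<^sub>R (1, 0) + (\<Sum>j\<in>UNIV. y $ j *\<^sub>R (0, axis j 1))"
      using basis_expansion[of y]
      by (simp add: prod_eq_iff fst_sum snd_sum scalar_mult_eq_scaleR)
    then have "f' (s, y) = s *\<^sub>R f' (1, 0) + (\<Sum>j\<in>UNIV. y $ j *\<^sub>R f' (0, axis j 1))"
      by (simp only: f'.add f'.sum f'.scaleR)
    then show ?thesis by (simp add: t x)
  qed
  then have "f' = (\<lambda>_. 0)" by (auto simp: fun_eq_iff)
  with f' show ?thesis by simp
qed

lemma constant_if_partials_zero:
  fixes f :: "real \<times> (real^'n::finite) \<Rightarrow> real"
  assumes "convex S" "p \<in> S" "q \<in> S"
    and "\<And>r. r \<in> S \<Longrightarrow> f differentiable (at r)"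
    and "\<And>r. r \<in> S \<Longrightarrow> D_t f r = 0" and "\<And>r j. r \<in> S \<Longrightarrow> D_x j f r = 0"
  shows "f p = f q"
proof -
  have "(f has_derivative (\<lambda>_. 0)) (at r within S)" if "r \<in> S" for r
    using has_derivative_zero_if_partials_zero[of f r] assms(4-6) that
    by (blast intro: has_derivative_at_withinI)
  from has_derivative_zero_constant[OF assms(1) this] show ?thesis using assms(2,3) by metis
qed

section \<open>Exponential phases\<close>

text \<open>The coefficient of \<open>t\<close> is the KdV dispersion relation: it makes \<open>exp (phase i a c p)\<close> a solution of
\<open>Ai = 0\<close>. For \<open>a = \<plusminus> 2 k\<close> the phase is \<open>\<plusminus> 2 (k x\<^sub>1 + k\<^sup>3 t)\<close> plus a constant.\<close>

definition phase :: "'n::finite \<Rightarrow> real \<Rightarrow> real \<Rightarrow> real \<times> (real^'n) \<Rightarrow> real" where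
  "phase i a c p = a * snd p $ i + a ^ 3 / 4 * fst p + c"

lemma phase_along_x:
  "phase i a c (p + s *\<^sub>R (0, axis j 1)) = phase i a c p + s * (if j = i then a else 0)"
  by (simp add: phase_def axis_def algebra_simps)

lemma phase_along_t: "phase i a c (p + s *\<^sub>R (1, 0)) = phase i a c p + s * (a ^ 3 / 4)"
  by (simp add: phase_def algebra_simps)

lemma D_x_phase:
  assumes "\<And>s. (\<phi> has_real_derivative \<phi>' s) (at s)"
  shows "D_x j (\<lambda>q. \<phi> (phase i a c q)) = (\<lambda>q. (if j = i then a else 0) * \<phi>' (phase i a c q))"
  unfolding D_x_def
proof (rule ext, rule partial_eq)
  fix p
  show "((\<lambda>s. \<phi> (phase i a c (p + s *\<^sub>R (0, axis j 1)))) has_real_derivative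
      (if j = i then a else 0) * \<phi>' (phase i a c p)) (at 0)"
    unfolding phase_along_x
    by (rule DERIV_cong[OF DERIV_chain2[OF assms, where Db = "(if j = i then a else 0)"]])
      (auto intro!: derivative_eq_intros)
qed

lemma D_t_phase:
  assumes "\<And>s. (\<phi> has_real_derivative \<phi>' s) (at s)"
  shows "D_t (\<lambda>q. \<phi> (phase i a c q)) = (\<lambda>q. a ^ 3 / 4 * \<phi>' (phase i a c q))"
  unfolding D_t_def
proof (rule ext, rule partial_eq)
  fix p
  show "((\<lambda>s. \<phi> (phase i a c (p + s *\<^sub>R (1, 0)))) has_real_derivative
      a ^ 3 / 4 * \<phi>' (phase i a c p)) (at 0)"
    unfolding phase_along_t
    by (rule DERIV_cong[OF DERIV_chain2[OF assms, where Db = "a ^ 3 / 4"]])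
      (auto intro!: derivative_eq_intros)
qed

lemma phase_differentiable: "phase i a c differentiable (at p)"
proof -
  have "((\<lambda>p. a * snd p $ i + a ^ 3 / 4 * fst p + c) has_derivative
     (\<lambda>h. a * snd h $ i + a ^ 3 / 4 * fst h)) (at p)"
    by (auto intro!: derivative_eq_intros bounded_linear.has_derivative[OF bounded_linear_vec_nth])
  then show ?thesis unfolding phase_def[abs_def] differentiable_def by blast
qed

lemma exp_phase_conditions:
  assumes \<Theta>: "\<And>p. \<Theta> p = 1 + exp (phase i a c p)"
  shows "Ai i \<Theta> p = 0" "W1 i \<Theta> p = 0" "j \<noteq> i \<Longrightarrow> WF F j \<Theta> p = 0"
proof -
  have "\<Theta> = (\<lambda>q. (\<lambda>s. 1 + exp s) (phase i a c q))" using \<Theta> by auto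
  note \<Theta> = this
  have 0: "((\<lambda>s. 1 + exp s) has_real_derivative exp s) (at s)" for s
    by (auto intro!: derivative_eq_intros)
  have K: "((\<lambda>s. k * exp s) has_real_derivative k * exp s) (at s)" for s k :: real
    by (auto intro!: derivative_eq_intros)
  have x: "D_x j \<Theta> = (\<lambda>q. (if j = i then a else 0) * exp (phase i a c q))" for j
    unfolding \<Theta> by (rule D_x_phase[OF 0])
  have t: "D_t \<Theta> = (\<lambda>q. a ^ 3 / 4 * exp (phase i a c q))"
    unfolding \<Theta> by (rule D_t_phase[OF 0])
  note xx = D_x_phase[where \<phi> = "\<lambda>s. k * exp s" and \<phi>' = "\<lambda>s. k * exp s" for k, OF K]
  show "Ai i \<Theta> p = 0" "W1 i \<Theta> p = 0"
    unfolding Ai_def W1_def x t xx by (auto simp: xx power2_eq_square power3_eq_cube simp flip: mult.assoc)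
  show "WF F j \<Theta> p = 0" if "j \<noteq> i"
    using that unfolding WF_def x xx by simp
qed

lemma D_x_D_x_ln_exp_phase:
  assumes F: "\<And>y. y \<ge> 1 \<Longrightarrow> F y = ln y" and \<Theta>: "\<And>p. \<Theta> p = 1 + exp (phase i a c p)"
  shows "D_x i (D_x i (\<lambda>q. F (\<Theta> q))) =
      (\<lambda>q. a\<^sup>2 * (exp (phase i a c q) / (1 + exp (phase i a c q))\<^sup>2))"
proof -
  have pos: "1 + exp s > (0::real)" for s by (simp add: add_pos_pos)
  have nz: "1 + exp s \<noteq> (0::real)" for s using pos[of s] by linarith
  have L: "((\<lambda>s. ln (1 + exp s)) has_real_derivative exp s / (1 + exp s)) (at s)" for s
    using pos[of s] by (auto intro!: derivative_eq_intros)
  have S: "((\<lambda>s. a * (exp s / (1 + exp s))) has_real_derivative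
      a * (exp s / (1 + exp s)\<^sup>2)) (at s)" for s
    using nz[of s] by (auto intro!: derivative_eq_intros simp: power2_eq_square field_simps)
  have "(\<lambda>q. F (\<Theta> q)) = (\<lambda>q. ln (1 + exp (phase i a c q)))"
    by (auto simp: \<Theta> F)
  then have 1: "D_x i (\<lambda>q. F (\<Theta> q)) = (\<lambda>q. a * (exp (phase i a c q) / (1 + exp (phase i a c q))))"
    using D_x_phase[of "\<lambda>s. ln (1 + exp s)", OF L, of i i a c] by simp
  show "D_x i (D_x i (\<lambda>q. F (\<Theta> q))) =
      (\<lambda>q. a\<^sup>2 * (exp (phase i a c q) / (1 + exp (phase i a c q))\<^sup>2))"
    unfolding 1 using D_x_phase[OF S, of i i a c] by (simp add: power2_eq_square mult.assoc)
qed

text \<open>The soliton profile in the variable \<open>exp s\<close>, which is the second derivative of \<open>ln (1 + exp s)\<close>.\<close>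

lemma sech_squared: "exp s / (1 + exp s)\<^sup>2 = (1 / cosh (s / 2))\<^sup>2 / 4" for s :: real
proof -
  have e: "exp s = exp (s / 2) * exp (s / 2)" by (simp flip: exp_add)
  have "1 + exp s = 2 * exp (s / 2) * cosh (s / 2)"
    unfolding cosh_def by (simp add: algebra_simps flip: exp_add)
  then show ?thesis by (subst e) (simp add: power2_eq_square)
qed

text \<open>Both signs of \<open>a\<close> occur, because \<open>cosh\<close> is even: a phase and its reflection describe the same soliton.\<close>

lemma Q_eq_phase:
  assumes "\<bar>a\<bar> = 2 * k"
  shows "Q i k (t, x + x0 *\<^sub>R axis i 1) =
    2 * (a\<^sup>2 * (exp (phase i a (a * x0) (t, x)) / (1 + exp (phase i a (a * x0) (t, x)))\<^sup>2))"
proof -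
  let ?p = "phase i a (a * x0) (t, x)"
  let ?q = "k * (x $ i + x0) + k ^ 3 * t"
  have a: "a = 2 * k \<or> a = - (2 * k)" using assms by linarith
  then have "?p = 2 * ?q \<or> ?p = - (2 * ?q)"
    by (auto simp: phase_def algebra_simps power3_eq_cube)
  then have "?p / 2 = ?q \<or> ?p / 2 = - ?q" by (elim disjE) simp_all
  then have "cosh (?p / 2) = cosh ?q" by (metis cosh_minus)
  moreover have "a\<^sup>2 = 4 * k\<^sup>2" using a by (auto simp: power2_eq_square)
  ultimately show ?thesis
    unfolding sech_squared by (simp add: Q_def axis_def)
qed

lemma affine_at_bot:
  fixes a b :: real
  shows "a > 0 \<Longrightarrow> filterlim (\<lambda>s. b + a * s) at_bot at_bot"
    and "a < 0 \<Longrightarrow> filterlim (\<lambda>s. b + a * s) at_bot at_top"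
proof -
  have Z: "b + a * s \<le> Z" if "a > 0 \<and> s \<le> (Z - b) / a \<or> a < 0 \<and> s \<ge> (Z - b) / a" for s Z
    using that by (auto simp: field_simps)
  show "a > 0 \<Longrightarrow> filterlim (\<lambda>s. b + a * s) at_bot at_bot"
    unfolding filterlim_at_bot eventually_at_bot_linorder using Z by blast
  show "a < 0 \<Longrightarrow> filterlim (\<lambda>s. b + a * s) at_bot at_top"
    unfolding filterlim_at_bot eventually_at_top_linorder using Z by blast
qed

lemma exp_phase_normalised:
  assumes \<Theta>: "\<And>p. \<Theta> p = 1 + exp (phase i a c p)" and "a \<noteq> 0"
  shows "normalised_phase i \<Theta>"
proof -
  have line: "\<Theta> (t, x + s *\<^sub>R axis i 1) = 1 + exp (phase i a c (t, x) + s * a)" for t x s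
    unfolding \<Theta> using phase_along_x[of i a c "(t, x)" s i] by simp
  have "((\<lambda>s. 1 + exp (b + s * a)) \<longlongrightarrow> 1 + 0) (if a > 0 then at_bot else at_top)" for b
  proof (intro tendsto_intros filterlim_compose[OF exp_at_bot])
    show "filterlim (\<lambda>s. b + s * a) at_bot (if a > 0 then at_bot else at_top)"
      using affine_at_bot[of a b] assms(2) by (auto simp: mult.commute)
  qed
  then show ?thesis unfolding normalised_phase_def line by (cases "a > 0") simp_all
qed

section \<open>Recovering the phase from the soliton\<close>

text \<open>Dividing by \<open>s\<close> shows that the slope vanishes.\<close>

lemma affine_tendsto_zero_imp_zero:
  fixes \<alpha> \<beta> :: real
  assumes "((\<lambda>s. \<alpha> + \<beta> * s) \<longlongrightarrow> 0) F" and "F = at_bot \<or> F = at_top"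
  shows "\<alpha> = 0 \<and> \<beta> = 0"
proof -
  have inv: "((\<lambda>s. inverse s :: real) \<longlongrightarrow> 0) F"
    using assms(2) tendsto_inverse_0 at_bot_le_at_infinity at_top_le_at_infinity
    by (metis tendsto_mono)
  have nt: "F \<noteq> bot" using assms(2) trivial_limit_at_bot_linorder trivial_limit_at_top_linorder by metis
  have ev: "eventually (\<lambda>s. s \<noteq> 0) F"
    using assms(2) eventually_gt_at_top[of "0::real"] eventually_gt_at_bot[of "0::real"]
    by (auto elim!: eventually_mono)
  have "((\<lambda>s. (\<alpha> + \<beta> * s) * inverse s - \<alpha> * inverse s) \<longlongrightarrow> 0 * 0 - \<alpha> * 0) F"
    by (intro tendsto_intros assms(1) inv)
  moreover have "eventually (\<lambda>s. (\<alpha> + \<beta> * s) * inverse s - \<alpha> * inverse s = \<beta>) F"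
    using ev by eventually_elim (simp add: field_simps)
  ultimately have "((\<lambda>_. \<beta>) \<longlongrightarrow> 0) F"
    using Lim_transform_eventually by fastforce
  then have "\<beta> = 0" using nt by (simp add: tendsto_const_iff)
  then show ?thesis using assms(1) nt by (simp add: tendsto_const_iff)
qed

text \<open>Two phases with logarithmic profile give the same \<open>u\<close> exactly if the difference of their logarithms is
affine in \<open>x\<^sub>1\<close>. Here the comparison phase is \<open>N = 1 + exp \<xi>\<close>. At the left end \<open>ln N\<close> tends to \<open>0\<close>, so a
phase normalised there is \<open>N\<close>; at the right end \<open>ln N - \<xi>\<close> tends to \<open>0\<close>, so a phase normalised there is
\<open>N exp (- \<xi>) = 1 + exp (- \<xi>)\<close>.\<close>

lemma normalised_soliton_phase:
  fixes \<Theta> :: "real \<times> (real^'n::finite) \<Rightarrow> real"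
  assumes "smooth \<Theta>" and ge: "\<And>p. \<Theta> p \<ge> 1" and norm: "normalised_phase i \<Theta>" and k: "k > 0"
    and Q: "\<And>t x. 2 * D_x i (D_x i (\<lambda>q. ln (\<Theta> q))) (t, x) = Q i k (t, x + x0 *\<^sub>R axis i 1)"
  shows "\<exists>a c. \<forall>p. \<Theta> p = 1 + exp (phase i a c p)"
proof -
  define \<xi> where "\<xi> = phase i (2 * k) (2 * k * x0)"
  define N where "N p = 1 + exp (\<xi> p)" for p
  define e :: "real \<times> (real^'n)" where "e = (0, axis i 1)"
  have pos: "\<Theta> p > 0" for p using ge[of p] by linarith
  define L1 where "L1 q = D_x i \<Theta> q / \<Theta> q" for q
  have L1: "D_x i (\<lambda>q. ln (\<Theta> q)) = L1"
    unfolding D_x_def L1_def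
  proof (rule ext, rule partial_eq)
    fix q
    show "((\<lambda>s. ln (\<Theta> (q + s *\<^sub>R (0, axis i 1)))) has_real_derivative
        partial (0, axis i 1) \<Theta> q / \<Theta> q) (at 0)"
      using DERIV_chain2[OF DERIV_ln_divide smooth_line_deriv0[OF assms(1), of q "(0, axis i 1)"]] pos[of q]
      by (simp flip: zero_prod_def)
  qed
  have u: "D_x i (D_x i (\<lambda>q. ln (\<Theta> q))) q = (2 * k)\<^sup>2 * (exp (\<xi> q) / (1 + exp (\<xi> q))\<^sup>2)" for q
  proof -
    have "\<bar>2 * k\<bar> = 2 * k" using k by simp
    from Q_eq_phase[OF this, of i "fst q" "snd q" x0] Q[of "fst q" "snd q"]
    have "2 * D_x i (D_x i (\<lambda>q. ln (\<Theta> q))) q = 2 * ((2 * k)\<^sup>2 * (exp (\<xi> q) / (1 + exp (\<xi> q))\<^sup>2))"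
      unfolding \<xi>_def prod.collapse by (rule trans[rotated])
    then show ?thesis unfolding mult_cancel_left by simp
  qed
  \<comment> \<open>On the line through \<open>p\<close>, \<open>L1\<close> and \<open>2 k E / (1 + E)\<close> are the derivatives of \<open>ln \<Theta>\<close> and \<open>ln N\<close>.\<close>
  have affine: "\<exists>\<beta>. \<forall>s. ln (\<Theta> (p + s *\<^sub>R e)) - ln (N (p + s *\<^sub>R e)) =
      ln (\<Theta> p) - ln (N p) + \<beta> * s" for p
  proof -
    define E where "E s = exp (\<xi> (p + s *\<^sub>R e))" for s
    have \<xi>: "\<xi> (p + s *\<^sub>R e) = \<xi> p + s * (2 * k)" for s
      unfolding \<xi>_def e_def phase_along_x by simp
    have E: "(E has_real_derivative 2 * k * E s) (at s)" for s
      unfolding E_def \<xi> by (auto intro!: derivative_eq_intros)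
    have Epos: "1 + E s > 0" for s by (simp add: E_def add_pos_pos)
    have E2: "((\<lambda>s. 2 * k * (E s / (1 + E s))) has_real_derivative (2 * k)\<^sup>2 * (E s / (1 + E s)\<^sup>2)) (at s)" for s
      using Epos[of s] by (auto intro!: derivative_eq_intros E simp: field_simps power2_eq_square)
    have \<Theta>1: "((\<lambda>s. \<Theta> (p + s *\<^sub>R e)) has_real_derivative D_x i \<Theta> (p + s *\<^sub>R e)) (at s)" for s
      unfolding D_x_def e_def by (rule smooth_line_deriv[OF assms(1)])
    \<comment> \<open>\<open>D_x\<close> yields a default value where the derivative does not exist, so differentiability of \<open>L1\<close> has to be known before its derivative can be read off from \<open>u\<close>.\<close>
    have L1_diff: "\<exists>d. ((\<lambda>s. L1 (q + s *\<^sub>R e)) has_real_derivative d) (at 0)" for q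
    proof -
      have "((\<lambda>s. L1 (q + s *\<^sub>R e)) has_real_derivative
          (D_x i (D_x i \<Theta>) q * \<Theta> q - D_x i \<Theta> q * D_x i \<Theta> q) / (\<Theta> q * \<Theta> q)) (at 0)"
        using DERIV_divide[OF smooth_line_deriv0[OF smooth_partial[OF assms(1), of e], of q e]
            smooth_line_deriv0[OF assms(1), of q e]] pos[of q]
        by (simp add: L1_def D_x_def e_def[symmetric])
      then show ?thesis by blast
    qed
    have L2: "((\<lambda>s. L1 (p + s *\<^sub>R e)) has_real_derivative (2 * k)\<^sup>2 * (E s / (1 + E s)\<^sup>2)) (at s)" for s
    proof -
      obtain d where d: "((\<lambda>r. L1 (p + s *\<^sub>R e + r *\<^sub>R e)) has_real_derivative d) (at 0)"
        using L1_diff by blast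
      have "d = D_x i (D_x i (\<lambda>q. ln (\<Theta> q))) (p + s *\<^sub>R e)"
        unfolding L1 unfolding D_x_def e_def[symmetric] using partial_eq[OF d] by simp
      also have "\<dots> = (2 * k)\<^sup>2 * (E s / (1 + E s)\<^sup>2)"
        unfolding E_def by (rule u)
      finally have "((\<lambda>r. L1 (p + s *\<^sub>R e + (- s + r) *\<^sub>R e)) has_real_derivative (2 * k)\<^sup>2 * (E s / (1 + E s)\<^sup>2)) (at s)"
        using d DERIV_shift[of "\<lambda>r. L1 (p + s *\<^sub>R e + (- s + r) *\<^sub>R e)" _ 0 s] by (simp add: add.commute)
      then show ?thesis by (simp add: algebra_simps)
    qed
    have d0: "((\<lambda>s. L1 (p + s *\<^sub>R e) - 2 * k * (E s / (1 + E s))) has_real_derivative 0) (at s)" for s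
      using DERIV_diff[OF L2 E2] by simp
    define \<beta> where "\<beta> = L1 (p + 0 *\<^sub>R e) - 2 * k * (E 0 / (1 + E 0))"
    have \<beta>: "L1 (p + s *\<^sub>R e) - 2 * k * (E s / (1 + E s)) = \<beta>" for s
      unfolding \<beta>_def by (rule DERIV_isconst_all[OF allI[OF d0]])
    have "((\<lambda>s. ln (\<Theta> (p + s *\<^sub>R e)) - ln (1 + E s) - \<beta> * s) has_real_derivative 0) (at s)" for s
    proof -
      have "((\<lambda>s. ln (\<Theta> (p + s *\<^sub>R e)) - ln (1 + E s) - \<beta> * s) has_real_derivative
          L1 (p + s *\<^sub>R e) - 2 * k * (E s / (1 + E s)) - \<beta>) (at s)"
        using pos[of "p + s *\<^sub>R e"] Epos[of s] by (auto intro!: derivative_eq_intros E \<Theta>1 simp: L1_def)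
      then show ?thesis unfolding \<beta> by simp
    qed
    then have "ln (\<Theta> (p + s *\<^sub>R e)) - ln (1 + E s) - \<beta> * s =
        ln (\<Theta> (p + 0 *\<^sub>R e)) - ln (1 + E 0) - \<beta> * 0" for s
      using DERIV_isconst_all[of "\<lambda>s. ln (\<Theta> (p + s *\<^sub>R e)) - ln (1 + E s) - \<beta> * s"] by blast
    then show ?thesis
      by (intro exI[of _ \<beta>]) (simp add: E_def N_def algebra_simps)
  qed
  have Npos: "N p > 0" for p by (simp add: N_def add_pos_pos)
  have \<xi>: "\<xi> (p + s *\<^sub>R e) = \<xi> p + 2 * k * s" for p s
    unfolding \<xi>_def e_def phase_along_x by simp
  have up: "filterlim (\<lambda>s. b + 2 * k * s) at_bot at_bot" for b
    using affine_at_bot(1)[of "2 * k" b] k by simp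
  have down: "filterlim (\<lambda>s. - (b + 2 * k * s)) at_bot at_top" for b
    using affine_at_bot(2)[of "- 2 * k" "- b"] k by simp
  have ln1: "((\<lambda>s. ln (1 + exp (g s))) \<longlongrightarrow> 0) G" if "filterlim g at_bot G" for g :: "real \<Rightarrow> real" and G
    using tendsto_ln[OF tendsto_add[OF tendsto_const[of 1] filterlim_compose[OF exp_at_bot that]]] by simp
  have line: "(\<lambda>s. \<Theta> (fst p, snd p + s *\<^sub>R axis i 1)) = (\<lambda>s. \<Theta> (p + s *\<^sub>R e))" for p
    by (auto simp: e_def intro!: arg_cong[of _ _ \<Theta>] prod_eqI)
  from norm consider (bot) "\<And>p. ((\<lambda>s. \<Theta> (p + s *\<^sub>R e)) \<longlongrightarrow> 1) at_bot"
    | (top) "\<And>p. ((\<lambda>s. \<Theta> (p + s *\<^sub>R e)) \<longlongrightarrow> 1) at_top"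
    unfolding normalised_phase_def line[symmetric] by metis
  then show ?thesis
  proof cases
    case bot
    have "\<Theta> p = N p" for p
    proof -
      obtain \<beta> where \<beta>: "\<And>s. ln (\<Theta> (p + s *\<^sub>R e)) - ln (N (p + s *\<^sub>R e)) = ln (\<Theta> p) - ln (N p) + \<beta> * s"
        using affine by blast
      have "((\<lambda>s. ln (\<Theta> (p + s *\<^sub>R e)) - ln (1 + exp (\<xi> p + 2 * k * s))) \<longlongrightarrow> ln 1 - 0) at_bot"
        by (intro tendsto_diff tendsto_ln bot ln1 up) auto
      then have "((\<lambda>s. ln (\<Theta> p) - ln (N p) + \<beta> * s) \<longlongrightarrow> 0) at_bot"
        using \<beta> by (simp add: N_def \<xi>)
      from affine_tendsto_zero_imp_zero[OF this] have "ln (\<Theta> p) = ln (N p)" by simp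
      then show ?thesis using pos Npos by simp
    qed
    then show ?thesis unfolding N_def \<xi>_def by blast
  next
    case top
    have "\<Theta> p = 1 + exp (- \<xi> p)" for p
    proof -
      obtain \<beta> where \<beta>: "\<And>s. ln (\<Theta> (p + s *\<^sub>R e)) - ln (N (p + s *\<^sub>R e)) = ln (\<Theta> p) - ln (N p) + \<beta> * s"
        using affine by blast
      have N: "ln (N q) = \<xi> q + ln (1 + exp (- \<xi> q))" for q
      proof -
        have "N q = exp (\<xi> q) * (1 + exp (- \<xi> q))"
          by (simp add: N_def algebra_simps flip: exp_add)
        moreover have "1 + exp (- \<xi> q) > 0" by (simp add: add_pos_pos)
        ultimately show ?thesis by (simp add: ln_mult)
      qed
      have "((\<lambda>s. ln (\<Theta> (p + s *\<^sub>R e)) - ln (1 + exp (- (\<xi> p + 2 * k * s)))) \<longlongrightarrow> ln 1 - 0) at_top"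
        by (intro tendsto_diff tendsto_ln top ln1 down) auto
      moreover have "ln (\<Theta> (p + s *\<^sub>R e)) - ln (1 + exp (- (\<xi> p + 2 * k * s))) =
          (ln (\<Theta> p) - ln (1 + exp (- \<xi> p))) + (\<beta> + 2 * k) * s" for s
        using \<beta>[of s] unfolding N \<xi> by (simp add: algebra_simps)
      ultimately have "((\<lambda>s. (ln (\<Theta> p) - ln (1 + exp (- \<xi> p))) + (\<beta> + 2 * k) * s) \<longlongrightarrow> 0) at_top"
        by simp
      from affine_tendsto_zero_imp_zero[OF this] have "ln (\<Theta> p) = ln (1 + exp (- \<xi> p))" by simp
      then show ?thesis using pos by (simp add: add_pos_pos)
    qed
    moreover have "- \<xi> p = phase i (- (2 * k)) (- (2 * k * x0)) p" for p
      by (simp add: \<xi>_def phase_def power3_eq_cube)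
    ultimately show ?thesis by metis
  qed
qed

section \<open>Solving the phase equations\<close>

lemma profile_has_derivative:
  assumes "smooth_profile F" "y \<ge> 1"
  shows "(profile_deriv n F has_real_derivative profile_deriv (Suc n) F y) (at y within {1..})"
proof -
  have "profile_deriv n F differentiable (at y within {1..})"
    using assms unfolding smooth_profile_def differentiable_on_def by auto
  then show ?thesis
    by (simp add: vector_derivative_works has_real_derivative_iff_has_vector_derivative profile_deriv_def)
qed

text \<open>The equation \<open>h'' = F'(h) (h')\<^sup>2\<close> integrates once to \<open>h' = c exp (F(h))\<close>. If \<open>c \<noteq> 0\<close>, then in the direction
in which \<open>h\<close> decreases it stays in the compact interval from \<open>1\<close> to \<open>h 0\<close>, where \<open>exp (F(h))\<close> has a
positive lower bound; so \<open>h\<close> decreases at least linearly and falls below \<open>1\<close>.\<close>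

lemma stationary_if_bounded_below:
  fixes h h1 F dF :: "real \<Rightarrow> real"
  assumes F: "\<And>y. y \<ge> 1 \<Longrightarrow> (F has_real_derivative dF y) (at y within {1..})"
    and h: "\<And>s. (h has_real_derivative h1 s) (at s)"
    and h1: "\<And>s. (h1 has_real_derivative dF (h s) * (h1 s)\<^sup>2) (at s)"
    and ge: "\<And>s. h s \<ge> 1"
  shows "h1 s = 0"
proof -
  have Fh: "((\<lambda>s. F (h s)) has_real_derivative dF (h s) * h1 s) (at s)" for s
  proof -
    have "(F has_real_derivative dF (h s)) (at (h s) within h ` UNIV)"
      using DERIV_subset[OF F[OF ge]] ge by (metis atLeast_iff image_subsetI)
    from DERIV_image_chain[OF this h] show ?thesis by (simp add: o_def)
  qed
  have "((\<lambda>s. h1 s * exp (- F (h s))) has_real_derivative 0) (at s)" for s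
    by (auto intro!: derivative_eq_intros h1 Fh simp: power2_eq_square algebra_simps)
  then obtain c where "\<And>s. h1 s * exp (- F (h s)) = c"
    using DERIV_isconst_all[of "\<lambda>s. h1 s * exp (- F (h s))"] by metis
  then have h1_eq: "h1 s = c * exp (F (h s))" for s
    by (metis exp_minus_inverse mult.assoc mult.commute mult.left_neutral)
  show ?thesis
  proof (cases "c = 0")
    case True then show ?thesis by (simp add: h1_eq)
  next
    case False
    \<comment> \<open>Reflected if necessary, so that \<open>H\<close> is decreasing.\<close>
    define H where "H s = h (- sgn c * s)" for s
    have H: "(H has_real_derivative - (\<bar>c\<bar> * exp (F (H s)))) (at s)" for s
      unfolding H_def
      by (rule DERIV_cong[OF DERIV_chain2[OF h, where Db = "- sgn c"]])
        (auto intro!: derivative_eq_intros simp: h1_eq abs_sgn)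
    have ge': "H s \<ge> 1" for s using ge by (simp add: H_def)
    have dec: "H s \<le> H 0" if "s \<ge> 0" for s
      by (rule DERIV_nonpos_imp_nonincreasing[OF that]) (use H in force)
    have "continuous_on {1..} F"
      using F by (auto simp: continuous_on_eq_continuous_within intro: DERIV_continuous)
    then have "continuous_on {1..H 0} F" by (rule continuous_on_subset) auto
    then obtain y where y: "\<And>z. z \<in> {1..H 0} \<Longrightarrow> F y \<le> F z"
      using continuous_attains_inf[of "{1..H 0}" F] ge'[of 0] by (metis atLeastAtMost_iff atLeastatMost_empty_iff2 compact_Icc)
    define k where "k = \<bar>c\<bar> * exp (F y)"
    have k: "k > 0" using False by (simp add: k_def)
    \<comment> \<open>A function that starts at \<open>H 0\<close> and decreases with speed at least \<open>k\<close> is nonpositive at this time.\<close>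
    define T where "T = H 0 / k"
    have T: "T > 0" using k ge'[of 0] by (simp add: T_def)
    from MVT2[OF T H] obtain z where z: "0 < z" "H T - H 0 = (T - 0) * - (\<bar>c\<bar> * exp (F (H z)))" by auto
    have "k \<le> \<bar>c\<bar> * exp (F (H z))"
      unfolding k_def using y[of "H z"] dec[of z] ge'[of z] z by (auto intro!: mult_left_mono)
    then have "T * k \<le> T * (\<bar>c\<bar> * exp (F (H z)))" using T by (intro mult_left_mono) auto
    then have "H T \<le> H 0 - T * k" using z by simp
    also have "\<dots> = 0" using k by (simp add: T_def)
    finally show ?thesis using ge'[of T] by simp
  qed
qed

lemma transversal_independence:
  assumes F: "\<And>y. y \<ge> 1 \<Longrightarrow> (F has_real_derivative profile_deriv 1 F y) (at y within {1..})"
    and \<Theta>: "smooth \<Theta>" and ge: "\<And>p. \<Theta> p \<ge> 1" and W: "\<And>p. WF F j \<Theta> p = 0"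
  shows "D_x j \<Theta> p = 0"
proof -
  let ?v = "(0, axis j 1) :: real \<times> (real^'a)"
  have "D_x j \<Theta> (p + 0 *\<^sub>R ?v) = 0"
  proof (rule stationary_if_bounded_below[OF F, where h = "\<lambda>s. \<Theta> (p + s *\<^sub>R ?v)" and ?h1.0 = "\<lambda>s. D_x j \<Theta> (p + s *\<^sub>R ?v)"])
    show "((\<lambda>s. \<Theta> (p + s *\<^sub>R ?v)) has_real_derivative D_x j \<Theta> (p + s *\<^sub>R ?v)) (at s)" for s
      unfolding D_x_def by (rule smooth_line_deriv[OF \<Theta>])
    have "((\<lambda>s. D_x j \<Theta> (p + s *\<^sub>R ?v)) has_real_derivative D_x j (D_x j \<Theta>) (p + s *\<^sub>R ?v)) (at s)" for s
      unfolding D_x_def by (rule smooth_line_deriv[OF smooth_partial[OF \<Theta>]])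
    moreover have "D_x j (D_x j \<Theta>) q = profile_deriv 1 F (\<Theta> q) * (D_x j \<Theta> q)\<^sup>2" for q
      using W[of q] by (simp add: WF_def)
    ultimately show "((\<lambda>s. D_x j \<Theta> (p + s *\<^sub>R ?v)) has_real_derivative
        profile_deriv 1 F (\<Theta> (p + s *\<^sub>R ?v)) * (D_x j \<Theta> (p + s *\<^sub>R ?v))\<^sup>2) (at s)" for s
      by metis
  qed (auto simp: ge)
  then show ?thesis by (simp add: zero_prod_def[symmetric])
qed

text \<open>Let \<open>g\<^sub>n\<close> be the \<open>n\<close>-th \<open>x\<^sub>1\<close>-derivative of \<open>\<Theta>\<close>. The condition \<open>W\<^sub>1 = 0\<close>, differentiated twice, gives
\<open>g\<^sub>2\<^sup>2 = g\<^sub>1 g\<^sub>3\<close>, \<open>g\<^sub>2 g\<^sub>3 = g\<^sub>1 g\<^sub>4\<close> and \<open>g\<^sub>3\<^sup>2 = g\<^sub>1 g\<^sub>5\<close>: the derivatives form a geometric progression with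
ratio \<open>\<rho> = g\<^sub>2 / g\<^sub>1\<close>. The condition \<open>Ai = 0\<close> turns \<open>t\<close>-derivatives into \<open>x\<^sub>1\<close>-derivatives of order three
higher, so \<open>\<rho>\<close> is locally constant where \<open>g\<^sub>1 \<noteq> 0\<close>, and there \<open>g\<^sub>1\<close> is a multiple of
\<open>exp (a x\<^sub>1 + (a\<^sup>3 / 4) t)\<close>. The lower bound on \<open>\<Theta>\<close> excludes \<open>a = 0\<close>, where \<open>\<Theta>\<close> would be
affine in \<open>x\<^sub>1\<close>, and a negative coefficient of the exponential.\<close>

lemma exp_phase_if_Ai_W1_zero:
  fixes \<Theta> :: "real \<times> (real^'n::finite) \<Rightarrow> real"
  assumes \<Theta>: "smooth \<Theta>" and ge: "\<And>p. \<Theta> p \<ge> 1"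
    and Ai: "\<And>p. Ai i \<Theta> p = 0" and W1: "\<And>p. W1 i \<Theta> p = 0"
    and trans: "\<And>j p. j \<noteq> i \<Longrightarrow> D_x j \<Theta> p = 0"
    and nz: "D_x i \<Theta> p0 \<noteq> 0"
  shows "\<exists>a b c. a \<noteq> 0 \<and> (\<forall>p. \<Theta> p = b + exp (phase i a c p))"
proof -
  define e :: "real \<times> (real^'n)" where "e = (0, axis i 1)"
  define g1 where "g1 = D_x i \<Theta>"
  define g2 where "g2 = D_x i g1"
  define g3 where "g3 = D_x i g2"
  define g4 where "g4 = D_x i g3"
  define g5 where "g5 = D_x i g4"
  have sm_x: "smooth (D_x j f)" if "smooth f" for f :: "real \<times> (real^'n) \<Rightarrow> real" and j
    using that by (simp add: D_x_def smooth_partial)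
  have sm: "smooth g1" "smooth g2" "smooth g3" "smooth g4"
    by (simp_all add: g1_def g2_def g3_def g4_def sm_x \<Theta>)
  have line: "((\<lambda>s. f (q + s *\<^sub>R (0, axis j 1))) has_real_derivative D_x j f q) (at 0)"
    if "smooth f" for f :: "real \<times> (real^'n) \<Rightarrow> real" and q j
    unfolding D_x_def by (rule smooth_line_deriv0[OF that])
  have line_t: "((\<lambda>s. f (q + s *\<^sub>R (1, 0))) has_real_derivative D_t f q) (at 0)"
    if "smooth f" for f :: "real \<times> (real^'n) \<Rightarrow> real" and q
    unfolding D_t_def by (rule smooth_line_deriv0[OF that])
  note l = line[OF sm(1), of _ i, folded g2_def e_def] line[OF sm(2), of _ i, folded g3_def e_def]
    line[OF sm(3), of _ i, folded g4_def e_def] line[OF sm(4), of _ i, folded g5_def e_def]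
  have w: "(g2 q)\<^sup>2 = g1 q * g3 q" for q
    using W1[of q] by (simp add: W1_def g1_def g2_def g3_def)
  have d1: "g2 q * g3 q = g1 q * g4 q" for q
  proof -
    have "((\<lambda>s. (g2 (q + s *\<^sub>R e))\<^sup>2) has_real_derivative 2 * g2 q * g3 q) (at 0)"
      by (auto intro!: derivative_eq_intros l)
    moreover have "((\<lambda>s. g1 (q + s *\<^sub>R e) * g3 (q + s *\<^sub>R e)) has_real_derivative g2 q * g3 q + g1 q * g4 q) (at 0)"
      by (auto intro!: derivative_eq_intros l)
    ultimately have "2 * g2 q * g3 q = g2 q * g3 q + g1 q * g4 q"
      unfolding w by (rule DERIV_unique)
    then show ?thesis by simp
  qed
  have d2: "(g3 q)\<^sup>2 = g1 q * g5 q" for q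
  proof -
    have "((\<lambda>s. g2 (q + s *\<^sub>R e) * g3 (q + s *\<^sub>R e)) has_real_derivative (g3 q)\<^sup>2 + g2 q * g4 q) (at 0)"
      by (auto intro!: derivative_eq_intros l simp: power2_eq_square)
    moreover have "((\<lambda>s. g1 (q + s *\<^sub>R e) * g4 (q + s *\<^sub>R e)) has_real_derivative g2 q * g4 q + g1 q * g5 q) (at 0)"
      by (auto intro!: derivative_eq_intros l)
    ultimately have "(g3 q)\<^sup>2 + g2 q * g4 q = g2 q * g4 q + g1 q * g5 q"
      unfolding d1 by (rule DERIV_unique)
    then show ?thesis by simp
  qed
  have scale: "D_x i (\<lambda>q. f q / 4) = (\<lambda>q. D_x i f q / 4)" if "smooth f" for f :: "real \<times> (real^'n) \<Rightarrow> real"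
    unfolding D_x_def
    by (rule ext, rule partial_eq, rule DERIV_cdivide, rule smooth_line_deriv0[OF that])
  have comm: "D_t (D_x i f) = D_x i (D_t f)" "D_x j (D_x i f) = D_x i (D_x j f)"
    if "smooth f" for f :: "real \<times> (real^'n) \<Rightarrow> real" and j
    using partial_commute[OF that] by (auto simp: D_t_def D_x_def)
  have t0: "D_t \<Theta> = (\<lambda>q. g3 q / 4)"
    using Ai by (auto simp: Ai_def g1_def g2_def g3_def)
  have t1: "D_t g1 = (\<lambda>q. g4 q / 4)"
    unfolding g1_def comm[OF \<Theta>] t0 scale[OF sm(3)] g4_def ..
  have t2: "D_t g2 = (\<lambda>q. g5 q / 4)"
    unfolding g2_def comm[OF sm(1)] t1 scale[OF sm(4)] g5_def ..
  have x0: "D_x j \<Theta> = (\<lambda>_. 0)" if "j \<noteq> i" for j using trans[OF that] by auto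
  have x1: "D_x j g1 = (\<lambda>_. 0)" if "j \<noteq> i" for j
    unfolding g1_def comm[OF \<Theta>] x0[OF that] D_x_zero ..
  have x2: "D_x j g2 = (\<lambda>_. 0)" if "j \<noteq> i" for j
    unfolding g2_def comm[OF sm(1)] x1[OF that] D_x_zero ..
  define \<rho> where "\<rho> q = g2 q / g1 q" for q
  define a where "a = \<rho> p0"
  define h where "h q = g1 q * exp (- phase i a 0 q)" for q
  have nz0: "g1 p0 \<noteq> 0" using nz by (simp add: g1_def)
  have diff_\<rho>: "\<rho> differentiable (at q)" if "g1 q \<noteq> 0" for q
    unfolding \<rho>_def[abs_def] using that sm by (intro differentiable_divide smooth_differentiable)
  have diff_h: "h differentiable (at q)" for q
  proof -
    have "(\<lambda>x. exp (- x) :: real) differentiable (at y)" for y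
      unfolding real_differentiable_def by (rule exI, rule DERIV_fun_exp) (rule DERIV_minus, rule DERIV_ident)
    then show ?thesis unfolding h_def[abs_def]
      by (rule differentiable_mult[OF smooth_differentiable[OF sm(1)]
            differentiable_compose[OF _ phase_differentiable]])
  qed
  have \<rho>x: "D_x j \<rho> q = 0" if "g1 q \<noteq> 0" for q j
  proof -
    have "((\<lambda>s. \<rho> (q + s *\<^sub>R (0, axis j 1))) has_real_derivative
        (D_x j g2 q * g1 q - g2 q * D_x j g1 q) / (g1 q * g1 q)) (at 0)"
      unfolding \<rho>_def using DERIV_divide[OF line[OF sm(2), of q j] line[OF sm(1), of q j]] that by (simp flip: zero_prod_def)
    moreover have "D_x j g2 q * g1 q - g2 q * D_x j g1 q = 0"
      using x1[of j] x2[of j] w[of q]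
      by (cases "j = i") (auto simp: g3_def[symmetric] g2_def[symmetric] power2_eq_square)
    ultimately show ?thesis unfolding D_x_def by (auto intro: partial_eq)
  qed
  have \<rho>t: "D_t \<rho> q = 0" if "g1 q \<noteq> 0" for q
  proof -
    have "((\<lambda>s. \<rho> (q + s *\<^sub>R (1, 0))) has_real_derivative
        (D_t g2 q * g1 q - g2 q * D_t g1 q) / (g1 q * g1 q)) (at 0)"
      unfolding \<rho>_def using DERIV_divide[OF line_t[OF sm(2), of q] line_t[OF sm(1), of q]] that by (simp flip: zero_prod_def)
    moreover have "g1 q * (D_t g2 q * g1 q - g2 q * D_t g1 q) = 0"
    proof -
      have "g1 q * (D_t g2 q * g1 q - g2 q * D_t g1 q)
          = (g1 q * (g1 q * g5 q) - g2 q * (g1 q * g4 q)) / 4"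
        by (simp add: t1 t2 algebra_simps diff_divide_distrib)
      also have "\<dots> = (g1 q * g3 q - (g2 q)\<^sup>2) * g3 q / 4"
        by (simp add: d1[symmetric] d2[symmetric] power2_eq_square algebra_simps)
      finally show ?thesis by (simp add: w)
    qed
    ultimately show ?thesis using that unfolding D_t_def by (auto intro: partial_eq)
  qed
  have g_powers: "g3 q = a\<^sup>2 * g1 q \<and> g4 q = a ^ 3 * g1 q" if "g1 q \<noteq> 0" "g2 q = a * g1 q" for q
  proof -
    have "g1 q * g3 q = (a * g1 q)\<^sup>2" using w[of q] that(2) by simp
    also have "\<dots> = g1 q * (a\<^sup>2 * g1 q)" by (simp add: power2_eq_square)
    finally have 3: "g3 q = a\<^sup>2 * g1 q" using that(1) by simp
    have "g1 q * g4 q = (a * g1 q) * (a\<^sup>2 * g1 q)" using d1[of q] unfolding that(2) 3 ..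
    also have "\<dots> = g1 q * (a ^ 3 * g1 q)" by (simp add: power2_eq_square power3_eq_cube)
    finally show ?thesis using 3 that(1) by simp
  qed
  have ex: "((\<lambda>s. exp (- phase i a 0 (q + s *\<^sub>R (0, axis j 1)))) has_real_derivative
      - (if j = i then a else 0) * exp (- phase i a 0 q)) (at 0)" for q j
    unfolding phase_along_x
    by (rule DERIV_cong[OF DERIV_fun_exp[where m = "- (if j = i then a else 0)"]]) (auto intro!: derivative_eq_intros)
  have et: "((\<lambda>s. exp (- phase i a 0 (q + s *\<^sub>R (1, 0)))) has_real_derivative
      - (a ^ 3 / 4) * exp (- phase i a 0 q)) (at 0)" for q
    unfolding phase_along_t by (auto intro!: derivative_eq_intros)
  have hx: "D_x j h q = 0" if "g1 q \<noteq> 0" "g2 q = a * g1 q" for q j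
  proof -
    have "((\<lambda>s. h (q + s *\<^sub>R (0, axis j 1))) has_real_derivative
       D_x j g1 q * exp (- phase i a 0 q) + - (if j = i then a else 0) * exp (- phase i a 0 q) * g1 q) (at 0)"
      unfolding h_def using DERIV_mult[OF line[OF sm(1), of q j] ex[of q j]] by (simp flip: zero_prod_def)
    moreover have "D_x j g1 q = (if j = i then a else 0) * g1 q"
      using x1[of j] that(2) by (simp add: g2_def)
    ultimately show ?thesis unfolding D_x_def by (auto intro: partial_eq)
  qed
  have ht: "D_t h q = 0" if "g1 q \<noteq> 0" "g2 q = a * g1 q" for q
  proof -
    have "((\<lambda>s. h (q + s *\<^sub>R (1, 0))) has_real_derivative
       D_t g1 q * exp (- phase i a 0 q) + - (a ^ 3 / 4) * exp (- phase i a 0 q) * g1 q) (at 0)"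
      unfolding h_def using DERIV_mult[OF line_t[OF sm(1), of q] et[of q]] by (simp flip: zero_prod_def)
    moreover have "D_t g1 q = a ^ 3 / 4 * g1 q"
      using g_powers[OF that] by (simp add: t1)
    ultimately show ?thesis unfolding D_t_def by (auto intro: partial_eq)
  qed
  \<comment> \<open>The set on which \<open>g1\<close> follows the exponential through \<open>p0\<close>. It is clopen: closed by continuity, and open because \<open>g1\<close> equals a nonzero exponential on it, so that \<open>\<rho>\<close> and \<open>h\<close> are constant on a small ball around each of its points.\<close>
  define S where "S = {q. h q = h p0 \<and> g2 q = a * g1 q}"
  have ct: "continuous_on UNIV g1" "continuous_on UNIV g2" "continuous_on UNIV h"
    using smooth_isCont[OF sm(1)] smooth_isCont[OF sm(2)] differentiable_imp_continuous_within[OF diff_h]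
    by (auto intro!: continuous_at_imp_continuous_on)
  have S_nz: "g1 q \<noteq> 0" if "q \<in> S" for q
    using that nz0 by (auto simp: S_def h_def)
  have "closed S" unfolding S_def
    by (intro closed_Collect_conj closed_Collect_eq continuous_intros ct)
  moreover have "open S"
    unfolding open_contains_ball
  proof
    fix q assume q: "q \<in> S"
    have "open {q. g1 q \<noteq> 0}" by (intro open_Collect_neq ct continuous_intros)
    then obtain d where d: "d > 0" "\<And>r. r \<in> ball q d \<Longrightarrow> g1 r \<noteq> 0"
      using S_nz[OF q] unfolding open_contains_ball by blast
    have "r \<in> S" if r: "r \<in> ball q d" for r
    proof -
      have g2: "g2 r = a * g1 r" if r: "r \<in> ball q d" for r
      proof -
        have "\<rho> q = \<rho> r"
          by (rule constant_if_partials_zero[of "ball q d"]) (use d r in \<open>auto intro!: diff_\<rho> \<rho>x \<rho>t\<close>)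
        moreover have "\<rho> q = a" using q S_nz[OF q] by (simp add: S_def \<rho>_def)
        ultimately have "\<rho> r = a" by simp
        then show ?thesis using d(2)[OF r] by (simp add: \<rho>_def nonzero_divide_eq_eq)
      qed
      have "h q = h r"
        by (rule constant_if_partials_zero[of "ball q d"]) (use d r in \<open>auto intro!: diff_h hx ht g2\<close>)
      with q g2[OF r] show ?thesis by (simp add: S_def)
    qed
    with d(1) show "\<exists>d>0. ball q d \<subseteq> S" by blast
  qed
  moreover have "p0 \<in> S" using nz0 by (simp add: S_def a_def \<rho>_def)
  ultimately have S: "S = UNIV" using clopen[of S] by blast
  have g2: "g2 q = a * g1 q" and g1_nz: "g1 q \<noteq> 0" and h: "h q = h p0" for q
    using S S_nz[of q] by (auto simp: S_def)
  define k where "k = h p0"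
  have g1: "g1 q = k * exp (phase i a 0 q)" for q
    using h[of q] by (simp add: h_def k_def exp_minus field_simps)
  have a: "a \<noteq> 0"
  proof
    assume "a = 0"
    have "((\<lambda>s. \<Theta> (p0 + s *\<^sub>R e) - k * s) has_real_derivative 0) (at s)" for s
    proof -
      have "((\<lambda>s. \<Theta> (p0 + s *\<^sub>R e)) has_real_derivative k) (at s)"
        using smooth_line_deriv[OF \<Theta>, of p0 e s] g1[of "p0 + s *\<^sub>R e"] \<open>a = 0\<close>
        by (simp add: g1_def D_x_def e_def phase_def)
      then show ?thesis by (auto intro!: derivative_eq_intros)
    qed
    then have "\<Theta> (p0 + s *\<^sub>R e) - k * s = \<Theta> (p0 + 0 *\<^sub>R e) - k * 0" for s
      using DERIV_isconst_all[of "\<lambda>s. \<Theta> (p0 + s *\<^sub>R e) - k * s"] by blast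
    from this[of "- \<Theta> p0 / k"] have "\<Theta> (p0 + (- \<Theta> p0 / k) *\<^sub>R e) = 0"
      using g1[of p0] nz0 by simp
    with ge[of "p0 + (- \<Theta> p0 / k) *\<^sub>R e"] show False by simp
  qed
  \<comment> \<open>For \<open>a \<noteq> 0\<close>, \<open>g1 / a\<close> is the nonconstant part of \<open>\<Theta>\<close>.\<close>
  have "\<Theta> q - g1 q / a = \<Theta> p0 - g1 p0 / a" for q
  proof (rule constant_if_partials_zero[of UNIV])
    fix r
    show "(\<lambda>q. \<Theta> q - g1 q / a) differentiable (at r)"
      using a by (intro differentiable_diff differentiable_divide smooth_differentiable \<Theta> sm differentiable_const)
    show "D_t (\<lambda>q. \<Theta> q - g1 q / a) r = 0"
    proof -
      have "((\<lambda>s. \<Theta> (r + s *\<^sub>R (1, 0)) - g1 (r + s *\<^sub>R (1, 0)) / a) has_real_derivative D_t \<Theta> r - D_t g1 r / a) (at 0)"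
        by (intro DERIV_diff DERIV_cdivide line_t \<Theta> sm)
      moreover have "D_t \<Theta> r - D_t g1 r / a = 0"
        using g_powers[OF g1_nz g2, of r] a by (simp add: t0 t1 power2_eq_square power3_eq_cube)
      ultimately show ?thesis unfolding D_t_def by (auto intro: partial_eq)
    qed
    show "D_x j (\<lambda>q. \<Theta> q - g1 q / a) r = 0" for j
    proof -
      have "((\<lambda>s. \<Theta> (r + s *\<^sub>R (0, axis j 1)) - g1 (r + s *\<^sub>R (0, axis j 1)) / a) has_real_derivative D_x j \<Theta> r - D_x j g1 r / a) (at 0)"
        by (intro DERIV_diff DERIV_cdivide line \<Theta> sm)
      moreover have "D_x j \<Theta> r - D_x j g1 r / a = 0"
        using x0[of j] x1[of j] g2[of r] a by (cases "j = i") (auto simp: g1_def[symmetric] g2_def[symmetric])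
      ultimately show ?thesis unfolding D_x_def by (auto intro: partial_eq)
    qed
  qed auto
  define b where "b = \<Theta> p0 - g1 p0 / a"
  define K where "K = k / a"
  have \<Theta>_eq: "\<Theta> q = b + K * exp (phase i a 0 q)" for q
    using \<open>\<And>q. \<Theta> q - g1 q / a = \<Theta> p0 - g1 p0 / a\<close>[of q] by (simp add: b_def K_def g1 algebra_simps)
  have "K > 0"
  proof (rule ccontr)
    assume "\<not> K > 0"
    moreover have "K \<noteq> 0" using nz0 g1[of p0] a by (auto simp: K_def)
    ultimately have K: "K < 0" by simp
    \<comment> \<open>The phase takes every real value; at this one \<open>\<Theta>\<close> would be \<open>b - \<bar>b\<bar> - 1 < 1\<close>.\<close>
    define y where "y = ln ((\<bar>b\<bar> + 1) / - K)"
    have "phase i a 0 (0, (y / a) *\<^sub>R axis i 1) = y" using a by (simp add: phase_def)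
    moreover have "exp y = (\<bar>b\<bar> + 1) / - K" unfolding y_def using K by (intro exp_ln divide_pos_pos) auto
    ultimately have "\<Theta> (0, (y / a) *\<^sub>R axis i 1) = b - (\<bar>b\<bar> + 1)"
      using K by (simp add: \<Theta>_eq)
    with ge[of "(0, (y / a) *\<^sub>R axis i 1)"] show False by linarith
  qed
  then have "\<Theta> q = b + exp (phase i a (ln K) q)" for q
    by (simp add: \<Theta>_eq phase_def exp_add)
  with a show ?thesis by blast
qed

section \<open>Recovering the profile from the travelling-wave equation\<close>

text \<open>The form in which every first integral below is evaluated: it is conserved, and its value is its limit
at \<open>- \<infinity>\<close>.\<close>

lemma constant_up_to_eq_limit_at_bot:
  fixes g :: "real \<Rightarrow> real"
  assumes der: "\<And>s. s \<le> m \<Longrightarrow> (g has_real_derivative 0) (at s)"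
    and lim: "(g \<longlongrightarrow> L) at_bot" and "s \<le> m"
  shows "g s = L"
proof -
  have "\<exists>c. \<forall>x\<in>{..m}. g x = c"
    by (rule has_field_derivative_zero_constant)
      (auto intro: has_field_derivative_at_within der)
  then obtain c where c: "\<And>x. x \<le> m \<Longrightarrow> g x = c" by auto
  have "eventually (\<lambda>x. g x = c) at_bot"
    using eventually_le_at_bot[of m] by eventually_elim (rule c)
  then have "(g \<longlongrightarrow> c) at_bot" by (simp add: tendsto_eventually)
  then have "L = c" using lim tendsto_unique trivial_limit_at_bot_linorder by blast
  with c assms(3) show ?thesis by simp
qed

text \<open>Think of \<open>f1, \<dots>, f5\<close> as the derivatives of \<open>f s = F (1 + exp s)\<close>, and of \<open>U = f2 = f''\<close> as the travelling
wave. The limits say that all of them behave like \<open>exp s\<close> at \<open>- \<infinity>\<close>. The equation integrates to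
\<open>U'' = U - 6 U\<^sup>2\<close> and, after multiplication by \<open>2 U'\<close>, to \<open>U'\<^sup>2 = U\<^sup>2 - 4 U\<^sup>3\<close>. As long as \<open>U > 0\<close>, the
derivative of \<open>U' / U\<close> is \<open>- 2 U = - 2 f1'\<close>, whence \<open>U' = U (1 - 2 f1)\<close>. Inserting this into the energy
identity leaves the logistic equation \<open>f1' = f1 (1 - f1)\<close>, and \<open>f1 \<sim> exp s\<close> selects
\<open>f1 = exp s / (1 + exp s)\<close>. Positivity of \<open>U\<close> persists, since at a first zero of \<open>U\<close> the formula would
still hold and give \<open>U > 0\<close>.\<close>

lemma travelling_wave_unique:
  fixes f1 f2 f3 f4 f5 :: "real \<Rightarrow> real"
  assumes f1: "\<And>s. (f1 has_real_derivative f2 s) (at s)"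
    and f2: "\<And>s. (f2 has_real_derivative f3 s) (at s)"
    and f3: "\<And>s. (f3 has_real_derivative f4 s) (at s)"
    and f4: "\<And>s. (f4 has_real_derivative f5 s) (at s)"
    and ode: "\<And>s. f5 s - f3 s + 12 * f2 s * f3 s = 0"
    and l1: "((\<lambda>s. f1 s * exp (- s)) \<longlongrightarrow> 1) at_bot"
    and l2: "((\<lambda>s. f2 s * exp (- s)) \<longlongrightarrow> 1) at_bot"
    and l3: "((\<lambda>s. f3 s * exp (- s)) \<longlongrightarrow> 1) at_bot"
    and l4: "(f4 \<longlongrightarrow> 0) at_bot"
  shows "f1 s = exp s / (1 + exp s)"
proof -
  have vanish: "(f \<longlongrightarrow> 0) at_bot" if "((\<lambda>s. f s * exp (- s)) \<longlongrightarrow> 1) at_bot" for f :: "real \<Rightarrow> real"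
    using tendsto_mult[OF that exp_at_bot] by (simp add: mult.assoc flip: exp_add)
  note v = vanish[OF l1] vanish[OF l2] vanish[OF l3]
  have f4_eq: "f4 s = f2 s - 6 * (f2 s)\<^sup>2" for s
  proof -
    have "f4 s - f2 s + 6 * (f2 s)\<^sup>2 = 0"
    proof (rule constant_up_to_eq_limit_at_bot[OF _ _ order_refl, where g = "\<lambda>s. f4 s - f2 s + 6 * (f2 s)\<^sup>2"])
      show "((\<lambda>s. f4 s - f2 s + 6 * (f2 s)\<^sup>2) has_real_derivative 0) (at s)" for s
        using ode[of s] by (auto intro!: derivative_eq_intros f4 f2 simp: ac_simps)
      show "((\<lambda>s. f4 s - f2 s + 6 * (f2 s)\<^sup>2) \<longlongrightarrow> 0) at_bot"
        by (rule tendsto_eq_intros l4 v refl | simp)+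
    qed
    then show ?thesis by simp
  qed
  have energy: "(f3 s)\<^sup>2 = (f2 s)\<^sup>2 - 4 * f2 s ^ 3" for s
  proof -
    have "(f3 s)\<^sup>2 - (f2 s)\<^sup>2 + 4 * f2 s ^ 3 = 0"
    proof (rule constant_up_to_eq_limit_at_bot[OF _ _ order_refl, where g = "\<lambda>s. (f3 s)\<^sup>2 - (f2 s)\<^sup>2 + 4 * f2 s ^ 3"])
      show "((\<lambda>s. (f3 s)\<^sup>2 - (f2 s)\<^sup>2 + 4 * f2 s ^ 3) has_real_derivative 0) (at s)" for s
        by (rule derivative_eq_intros f3 f2 refl | simp add: f4_eq algebra_simps power2_eq_square power3_eq_cube)+
      show "((\<lambda>s. (f3 s)\<^sup>2 - (f2 s)\<^sup>2 + 4 * f2 s ^ 3) \<longlongrightarrow> 0) at_bot"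
        by (rule tendsto_eq_intros v refl | simp)+
    qed
    then show ?thesis by simp
  qed
  have sol: "f1 s = exp s / (1 + exp s) \<and> f2 s = f1 s - (f1 s)\<^sup>2"
    if pos: "\<And>s. s \<le> m \<Longrightarrow> f2 s > 0" and "s \<le> m" for m s
  proof -
    have r: "f3 s = f2 s * (1 - 2 * f1 s)" if "s \<le> m" for s
    proof -
      have "f3 s / f2 s + 2 * f1 s = 1"
      proof (rule constant_up_to_eq_limit_at_bot[OF _ _ that, where g = "\<lambda>s. f3 s / f2 s + 2 * f1 s"])
        show "((\<lambda>s. f3 s / f2 s + 2 * f1 s) has_real_derivative 0) (at s)" if "s \<le> m" for s
        proof -
          have "((\<lambda>s. f3 s / f2 s + 2 * f1 s) has_real_derivative
              (f4 s * f2 s - f3 s * f3 s) / (f2 s * f2 s) + 2 * f2 s) (at s)"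
            using pos[OF that] by (auto intro!: derivative_eq_intros f1 f2 f3)
          moreover have "f4 s * f2 s - f3 s * f3 s = - 2 * f2 s ^ 3"
            using energy[of s] by (simp add: f4_eq power2_eq_square power3_eq_cube algebra_simps)
          ultimately show ?thesis using pos[OF that] by (simp add: power3_eq_cube)
        qed
        have "((\<lambda>s. (f3 s * exp (- s)) / (f2 s * exp (- s)) + 2 * f1 s) \<longlongrightarrow> 1 / 1 + 2 * 0) at_bot"
          by (intro tendsto_intros l2 l3 v) auto
        then show "((\<lambda>s. f3 s / f2 s + 2 * f1 s) \<longlongrightarrow> 1) at_bot" by simp
      qed
      then show ?thesis using pos[OF that] by (simp add: field_simps)
    qed
    have logistic: "f2 s = f1 s * (1 - f1 s)" if "s \<le> m" for s
    proof -
      have "(f2 s)\<^sup>2 * (1 - 2 * f1 s)\<^sup>2 = (f2 s)\<^sup>2 * (1 - 4 * f2 s)"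
        using energy[of s] unfolding r[OF that] by (simp add: power2_eq_square power3_eq_cube algebra_simps)
      then have "(1 - 2 * f1 s)\<^sup>2 = 1 - 4 * f2 s" using pos[OF that] by simp
      then show ?thesis by (simp add: power2_eq_square algebra_simps)
    qed
    have lt1: "f1 s < 1" if "s \<le> m" for s
      using pos[OF that] unfolding logistic[OF that] by (auto simp: zero_less_mult_iff)
    \<comment> \<open>The quantity \<open>f1 / (1 - f1)\<close> grows exactly like \<open>exp s\<close> along the logistic equation.\<close>
    have "f1 s * exp (- s) / (1 - f1 s) = 1"
    proof (rule constant_up_to_eq_limit_at_bot[OF _ _ \<open>s \<le> m\<close>, where g = "\<lambda>s. f1 s * exp (- s) / (1 - f1 s)"])
      show "((\<lambda>s. f1 s * exp (- s) / (1 - f1 s)) has_real_derivative 0) (at s)" if "s \<le> m" for s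
        using lt1[OF that]
        by (auto intro!: derivative_eq_intros f1 simp: logistic[OF that] algebra_simps)
      have "((\<lambda>s. f1 s * exp (- s) / (1 - f1 s)) \<longlongrightarrow> 1 / (1 - 0)) at_bot"
        by (intro tendsto_intros l1 v) auto
      then show "((\<lambda>s. f1 s * exp (- s) / (1 - f1 s)) \<longlongrightarrow> 1) at_bot" by simp
    qed
    then have "f1 s = exp s * (1 - f1 s)" using lt1[OF \<open>s \<le> m\<close>] by (simp add: exp_minus field_simps)
    then have "f1 s * (1 + exp s) = exp s" by (simp add: algebra_simps)
    moreover have "1 + exp s \<noteq> 0" by (metis add_pos_pos exp_gt_zero less_irrefl zero_less_one)
    ultimately show ?thesis using logistic[OF \<open>s \<le> m\<close>]
      by (simp add: field_simps power2_eq_square)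
  qed
  have "eventually (\<lambda>s. f2 s * exp (- s) > 0) at_bot"
    by (rule order_tendstoD(1)[OF l2]) simp
  then obtain m0 where m0: "\<And>s. s \<le> m0 \<Longrightarrow> f2 s > 0"
    unfolding eventually_at_bot_linorder by (auto simp: zero_less_mult_iff)
  have "f2 s > 0" for s
  proof (rule ccontr)
    \<comment> \<open>The infimum \<open>m\<close> of \<open>N\<close> is the first zero of \<open>f2\<close>; the formula holds to the left of \<open>m\<close> and passes to the limit.\<close>
    define N where "N = {s. f2 s \<le> 0}"
    assume "\<not> f2 s > 0"
    then have "N \<noteq> {}" by (auto simp: N_def not_less)
    moreover have bdd: "bdd_below N" by (rule bdd_belowI[of _ m0]) (metis N_def linorder_linear mem_Collect_eq m0 not_less)
    moreover have "closed N" unfolding N_def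
      using DERIV_isCont[OF f2] by (intro closed_Collect_le continuous_at_imp_continuous_on) auto
    ultimately have "Inf N \<in> N" by (rule closed_contains_Inf)
    define m where "m = Inf N"
    have m: "f2 m \<le> 0" using \<open>Inf N \<in> N\<close> by (simp add: N_def m_def)
    have below: "f2 s > 0" if "s < m" for s
      using that bdd cInf_lower[of s N] by (force simp: N_def m_def not_less)
    have eq: "f1 s = exp s / (1 + exp s) \<and> f2 s = f1 s - (f1 s)\<^sup>2" if "s < m" for s
      by (rule sol[of s]) (use that below in auto)
    have nz: "1 + exp s \<noteq> 0" for s :: real
      by (metis add_pos_pos exp_gt_zero less_irrefl zero_less_one)
    have "(f2 \<longlongrightarrow> f2 m) (at_left m)" "(f1 \<longlongrightarrow> f1 m) (at_left m)"
      using DERIV_isCont[OF f2] DERIV_isCont[OF f1] by (auto simp: isCont_def intro: tendsto_within_subset)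
    note lims = this
    have ev: "eventually (\<lambda>s. s < m) (at_left m)" by (simp add: eventually_at_filter)
    have "((\<lambda>s. exp s / (1 + exp s)) \<longlongrightarrow> f1 m) (at_left m)"
      by (rule Lim_transform_eventually[OF lims(2)]) (use ev in \<open>eventually_elim, simp add: eq\<close>)
    moreover have "((\<lambda>s. exp s / (1 + exp s)) \<longlongrightarrow> exp m / (1 + exp m)) (at_left m)"
      by (intro tendsto_intros nz)
    ultimately have f1m: "f1 m = exp m / (1 + exp m)"
      using tendsto_unique trivial_limit_at_left_real by blast
    have "((\<lambda>s. f1 s - (f1 s)\<^sup>2) \<longlongrightarrow> f2 m) (at_left m)"
      by (rule Lim_transform_eventually[OF lims(1)]) (use ev in \<open>eventually_elim, simp add: eq\<close>)
    moreover have "((\<lambda>s. f1 s - (f1 s)\<^sup>2) \<longlongrightarrow> f1 m - (f1 m)\<^sup>2) (at_left m)"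
      by (intro tendsto_intros lims)
    ultimately have "f2 m = f1 m * (1 - f1 m)"
      using tendsto_unique trivial_limit_at_left_real by (fastforce simp: algebra_simps power2_eq_square)
    also have "\<dots> > 0"
    proof (rule mult_pos_pos)
      show "f1 m > 0" unfolding f1m by (simp add: add_pos_pos)
      show "1 - f1 m > 0" unfolding f1m using nz[of m] by (simp add: field_simps add_pos_pos)
    qed
    finally show False using m by simp
  qed
  then show ?thesis using sol[of s s] by blast
qed

text \<open>For this phase \<open>u\<close> is a function of the single variable \<open>s = phase\<close>, with \<open>\<partial>\<^sub>1 = a d/ds\<close> and
\<open>\<partial>\<^sub>t = (a\<^sup>3 / 4) d/ds\<close>, so the partial differential equation is \<open>2 a\<^sup>5\<close> times an ordinary one for
\<open>f s = F (1 + exp s)\<close>. Every derivative of \<open>f\<close> is \<open>exp s F' (1 + exp s)\<close> plus higher powers of \<open>exp s\<close> with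
bounded coefficients near \<open>- \<infinity>\<close>, so \<open>F' 1 = 1\<close> supplies the asymptotics that select the logarithm.\<close>

lemma profile_log_if_exp_phase:
  assumes F: "smooth_profile F" and F1: "F 1 = 0" "profile_deriv 1 F 1 = 1"
    and \<Theta>: "\<And>p. \<Theta> p = 1 + exp (phase i a c p)" and a: "a \<noteq> 0"
    and u: "\<And>p. u p = 2 * D_x i (D_x i (\<lambda>q. F (\<Theta> q))) p" and ZK: "ZK_solution i u"
    and y: "y \<ge> 1"
  shows "F y = ln y"
proof -
  define P where "P n s = profile_deriv n F (1 + exp s)" for n s
  have cont: "continuous_on {1..} (profile_deriv n F)" for n
    using profile_has_derivative[OF F, of _ n]
    by (auto simp: continuous_on_eq_continuous_within intro: DERIV_continuous)
  have interior: "(profile_deriv n F has_real_derivative profile_deriv (Suc n) F y) (at y)"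
    if "y > 1" for n y
  proof -
    have "at y within {1..} = at y" using that by (intro at_within_interior) simp
    then show ?thesis using profile_has_derivative[OF F, of y n] that by simp
  qed
  have P: "(P n has_real_derivative exp s * P (Suc n) s) (at s)" for n s
    unfolding P_def[abs_def]
    by (rule DERIV_cong[OF DERIV_chain2[OF interior, where Db = "exp s"]])
      (auto intro!: derivative_eq_intros)
  have P_lim: "(P n \<longlongrightarrow> profile_deriv n F 1) at_bot" for n
    unfolding P_def[abs_def]
    by (rule continuous_on_tendsto_compose[OF cont])
      (use tendsto_add[OF tendsto_const[of 1] exp_at_bot] in auto)
  define T where "T m n s = m * (exp s ^ n * P n s)" for m :: real and n s
  have T: "(T m n has_real_derivative T (m * real n) n s + T m (Suc n) s) (at s)" for m n s
  proof -
    have "((\<lambda>s. exp (real n * s) * P n s) has_real_derivative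
        real n * (exp (real n * s) * P n s) + exp (real n * s) * (exp s * P (Suc n) s)) (at s)"
      by (rule DERIV_cong[OF DERIV_mult[OF DERIV_fun_exp[of "\<lambda>s. real n * s" "real n"] P]])
        (auto intro!: derivative_eq_intros)
    from DERIV_cmult[OF this[unfolded exp_of_nat_mult], of m] show ?thesis
      by (simp add: T_def[abs_def] algebra_simps)
  qed
  \<comment> \<open>The derivatives of \<open>s \<mapsto> F (1 + exp s)\<close>; the coefficients are Stirling numbers of the second kind.\<close>
  define f1 where "f1 s = T 1 1 s" for s
  define f2 where "f2 s = T 1 1 s + T 1 2 s" for s
  define f3 where "f3 s = T 1 1 s + T 3 2 s + T 1 3 s" for s
  define f4 where "f4 s = T 1 1 s + T 7 2 s + T 6 3 s + T 1 4 s" for s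
  define f5 where "f5 s = T 1 1 s + T 15 2 s + T 25 3 s + T 10 4 s + T 1 5 s" for s
  have f0: "((\<lambda>s. F (1 + exp s)) has_real_derivative f1 s) (at s)" for s
    using P[of 0 s] by (simp add: P_def[abs_def] T_def f1_def profile_deriv_def)
  have f: "(f1 has_real_derivative f2 s) (at s)" "(f2 has_real_derivative f3 s) (at s)"
     "(f3 has_real_derivative f4 s) (at s)" "(f4 has_real_derivative f5 s) (at s)" for s
    unfolding f1_def[abs_def] f2_def[abs_def] f3_def[abs_def] f4_def[abs_def] f5_def
    by (rule DERIV_cong, (rule DERIV_add T[of _ 1, unfolded Suc_1] T)+, simp add: T_def algebra_simps)+
  have ode: "f5 s - f3 s + 12 * f2 s * f3 s = 0" for s
  proof -
    have DF: "D_x i (\<lambda>q. F (\<Theta> q)) = (\<lambda>q. a * f1 (phase i a c q))"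
      unfolding \<Theta> using D_x_phase[of "\<lambda>s. F (1 + exp s)", OF f0, of i i a c] by simp
    have u_eq: "u = (\<lambda>q. 2 * a\<^sup>2 * f2 (phase i a c q))"
      unfolding fun_eq_iff u DF
      using D_x_phase[of "\<lambda>s. a * f1 s", OF DERIV_cmult[OF f(1)], of i i a c] by (simp add: power2_eq_square)
    have ut: "D_t u = (\<lambda>q. a ^ 5 / 2 * f3 (phase i a c q))"
      unfolding u_eq using D_t_phase[of "\<lambda>s. 2 * a\<^sup>2 * f2 s", OF DERIV_cmult[OF f(2)], of i a c]
      by (simp add: eval_nat_numeral mult_ac)
    have ux: "D_x j u = (\<lambda>q. (if j = i then a else 0) * (2 * a\<^sup>2 * f3 (phase i a c q)))" for j
      unfolding u_eq by (rule D_x_phase[OF DERIV_cmult[OF f(2)]])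
    have uxx: "D_x j (D_x j u) = (\<lambda>q. if j = i then 2 * a ^ 4 * f4 (phase i a c q) else 0)" for j
      unfolding ux mult.assoc[symmetric]
      using D_x_phase[of "\<lambda>s. ((if j = i then a else 0) * 2 * a\<^sup>2) * f3 s", OF DERIV_cmult[OF f(3)], of j i a c]
      by (auto simp: eval_nat_numeral mult_ac)
    have lap: "(\<lambda>q. laplacian u q + 3 * (u q)\<^sup>2) =
        (\<lambda>q. (\<lambda>s. 2 * a ^ 4 * f4 s + 12 * a ^ 4 * (f2 s)\<^sup>2) (phase i a c q))"
      unfolding laplacian_def uxx by (simp add: u_eq power_mult_distrib mult.assoc)
    have d: "((\<lambda>s. 2 * a ^ 4 * f4 s + 12 * a ^ 4 * (f2 s)\<^sup>2) has_real_derivative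
        2 * a ^ 4 * f5 s + 24 * a ^ 4 * (f2 s * f3 s)) (at s)" for s
      by (rule derivative_eq_intros f refl | simp)+
    \<comment> \<open>A point where the phase takes the given value \<open>s\<close>.\<close>
    let ?p = "(0, ((s - c) / a) *\<^sub>R axis i 1)"
    have p: "phase i a c ?p = s" using a by (simp add: phase_def)
    have "- 4 * D_t u ?p + D_x i (\<lambda>q. laplacian u q + 3 * (u q)\<^sup>2) ?p = 0"
      using ZK unfolding ZK_solution_def by blast
    then have "- 4 * (a ^ 5 / 2 * f3 s) + a * (2 * a ^ 4 * f5 s + 24 * a ^ 4 * (f2 s * f3 s)) = 0"
      unfolding ut lap D_x_phase[OF d] p by simp
    then have "2 * a ^ 5 * (f5 s - f3 s + 12 * f2 s * f3 s) = 0"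
      by (simp add: algebra_simps eval_nat_numeral)
    then show ?thesis using a by simp
  qed
  have P1: "(P 1 \<longlongrightarrow> 1) at_bot" using P_lim[of 1] F1(2) by simp
  have f1: "f1 s = exp s / (1 + exp s)" for s
  proof (rule travelling_wave_unique[OF f ode])
    have "f1 s * exp (- s) = P 1 s" for s by (simp add: f1_def T_def exp_minus)
    then show "((\<lambda>s. f1 s * exp (- s)) \<longlongrightarrow> 1) at_bot" using P1 by simp
    have e2: "f2 s * exp (- s) = P 1 s + exp s * P 2 s" for s
      by (simp add: f2_def T_def exp_minus power2_eq_square field_simps)
    show "((\<lambda>s. f2 s * exp (- s)) \<longlongrightarrow> 1) at_bot"
      unfolding e2 by (rule tendsto_eq_intros P1 P_lim exp_at_bot refl | simp)+
    have e3: "f3 s * exp (- s) = P 1 s + exp s * (3 * P 2 s + exp s * P 3 s)" for s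
      by (simp add: f3_def T_def exp_minus power2_eq_square power3_eq_cube field_simps)
    show "((\<lambda>s. f3 s * exp (- s)) \<longlongrightarrow> 1) at_bot"
      unfolding e3 by (rule tendsto_eq_intros P1 P_lim exp_at_bot refl | simp)+
    show "(f4 \<longlongrightarrow> 0) at_bot"
      unfolding f4_def[abs_def] T_def by (rule tendsto_eq_intros P1 P_lim exp_at_bot refl | simp)+
  qed
  have F': "profile_deriv 1 F y = 1 / y" if "y > 1" for y
  proof -
    have "(y - 1) * profile_deriv 1 F y = (y - 1) * (1 / y)"
      using f1[of "ln (y - 1)"] that by (simp add: f1_def T_def P_def)
    then show ?thesis using that unfolding mult_cancel_left by simp
  qed
  show ?thesis
  proof (cases "y = 1")
    case False
    with y have "1 < y" by simp
    have "(\<lambda>y. F y - ln y) y = (\<lambda>y. F y - ln y) 1"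
    proof (rule DERIV_isconst2[OF \<open>1 < y\<close>])
      show "continuous_on {1..y} (\<lambda>y. F y - ln y)"
        using continuous_on_subset[OF cont[of 0], of "{1..y}"]
        by (intro continuous_intros) (auto simp: profile_deriv_def)
      show "((\<lambda>y. F y - ln y) has_real_derivative 0) (at x)" if "1 < x" "x < y" for x
        using interior[of x 0] F'[of x] that
        by (auto intro!: derivative_eq_intros simp: profile_deriv_def)
    qed (use y in auto)
    then show ?thesis using F1 by simp
  qed (simp add: F1)
qed

section \<open>The characterisation\<close>

theorem theorem1p16:
  fixes i :: "'n::finite"
    and F :: "real \<Rightarrow> real"
    and \<Theta> u :: "real \<times> (real^'n) \<Rightarrow> real"
  assumes "smooth_profile F" and "smooth \<Theta>" and "smooth u"
    and "\<forall>p. \<Theta> p > 0"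
    and "closure (range \<Theta>) = {1..}"
    and "F 1 = 0" and "profile_deriv 1 F 1 = 1"
    and "profile_deriv 2 F 1 = -1" and "profile_deriv 3 F 1 = 2"
    and "\<forall>p. u p = 2 * D_x i (D_x i (\<lambda>q. F (\<Theta> q))) p"
    and "ZK_solution i u"
  shows "((\<exists>k>0. \<exists>x0. \<forall>t x. u (t, x) = Q i k (t, x + x0 *\<^sub>R axis i 1)) \<and>
          (\<forall>y\<ge>1. F y = ln y) \<and> normalised_phase i \<Theta>)
     \<longleftrightarrow> (\<forall>p. Ai i \<Theta> p = 0 \<and> W1 i \<Theta> p = 0 \<and> (\<forall>j. j \<noteq> i \<longrightarrow> WF F j \<Theta> p = 0))"
proof
  have ge: "\<Theta> p \<ge> 1" for p
    using closure_subset[of "range \<Theta>"] unfolding assms(5) by auto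
  {
    assume L: "(\<exists>k>0. \<exists>x0. \<forall>t x. u (t, x) = Q i k (t, x + x0 *\<^sub>R axis i 1)) \<and>
          (\<forall>y\<ge>1. F y = ln y) \<and> normalised_phase i \<Theta>"
    then obtain k x0 where k: "k > 0" and Q: "\<And>t x. u (t, x) = Q i k (t, x + x0 *\<^sub>R axis i 1)" by blast
    have "(\<lambda>q. F (\<Theta> q)) = (\<lambda>q. ln (\<Theta> q))" using L ge by auto
    with Q assms(10) have "2 * D_x i (D_x i (\<lambda>q. ln (\<Theta> q))) (t, x) = Q i k (t, x + x0 *\<^sub>R axis i 1)" for t x
      by metis
    then obtain a c where "\<And>p. \<Theta> p = 1 + exp (phase i a c p)"
      using normalised_soliton_phase[OF assms(2) ge _ k] L by blast
    from exp_phase_conditions[OF this]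
    show "\<forall>p. Ai i \<Theta> p = 0 \<and> W1 i \<Theta> p = 0 \<and> (\<forall>j. j \<noteq> i \<longrightarrow> WF F j \<Theta> p = 0)" by blast
  }
  assume R: "\<forall>p. Ai i \<Theta> p = 0 \<and> W1 i \<Theta> p = 0 \<and> (\<forall>j. j \<noteq> i \<longrightarrow> WF F j \<Theta> p = 0)"
  have "(F has_real_derivative profile_deriv 1 F y) (at y within {1..})" if "y \<ge> 1" for y
    using profile_has_derivative[OF assms(1) that, of 0] by (simp add: profile_deriv_def)
  then have trans: "D_x j \<Theta> p = 0" if "j \<noteq> i" for j p
    using transversal_independence[OF _ assms(2) ge] R that by blast
  \<comment> \<open>A constant phase cannot have a range that is dense in the half-line.\<close>
  have "\<exists>p0. D_x i \<Theta> p0 \<noteq> 0"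
  proof (rule ccontr)
    assume "\<not> ?thesis"
    then have x0: "D_x i \<Theta> = (\<lambda>_. 0)" by auto
    have t0: "D_t \<Theta> p = 0" for p using R[rule_format, of p] by (simp add: Ai_def x0 D_x_zero)
    have xj: "D_x j \<Theta> p = 0" for j p
      by (cases "j = i") (simp_all only: x0 trans not_False_eq_True)
    have "\<Theta> p = \<Theta> 0" for p
      by (rule constant_if_partials_zero[of UNIV])
        (simp_all only: convex_UNIV UNIV_I t0 xj smooth_differentiable[OF assms(2)])
    then have "range \<Theta> = {\<Theta> 0}" by auto
    then have "{1..} = {\<Theta> 0}" using assms(5) by simp
    then have "(1::real) = 2" by (metis atLeast_iff one_le_numeral order_refl singletonD)
    then show False by simp
  qed
  then obtain a b c where a: "a \<noteq> 0" and "\<And>p. \<Theta> p = b + exp (phase i a c p)"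
    using exp_phase_if_Ai_W1_zero[OF assms(2) ge _ _ trans] R by blast
  note \<Theta>b = this(2)
  have "range \<Theta> = {b<..}"
  proof (intro equalityI subsetI)
    fix y assume "y \<in> {b<..}"
    then have "\<Theta> (0, ((ln (y - b) - c) / a) *\<^sub>R axis i 1) = y"
      using a by (simp add: \<Theta>b phase_def)
    then show "y \<in> range \<Theta>" by (metis rangeI)
  qed (auto simp: \<Theta>b)
  then have "{b..} = {1..}" using assms(5) by (simp add: closure_greaterThan)
  then have "b = 1" by (metis atLeast_eq_iff)
  then have \<Theta>: "\<And>p. \<Theta> p = 1 + exp (phase i a c p)" using \<Theta>b by simp
  have ln: "F y = ln y" if "y \<ge> 1" for y
    using profile_log_if_exp_phase[OF assms(1,6,7) \<Theta> a _ assms(11) that] assms(10) by blast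
  have "u (t, x) = Q i (\<bar>a\<bar> / 2) (t, x + (c / a) *\<^sub>R axis i 1)" for t x
    using Q_eq_phase[of a "\<bar>a\<bar> / 2" i t x "c / a"] a assms(10) D_x_D_x_ln_exp_phase[OF ln \<Theta>] by simp
  moreover have "\<bar>a\<bar> / 2 > 0" using a by simp
  ultimately show "(\<exists>k>0. \<exists>x0. \<forall>t x. u (t, x) = Q i k (t, x + x0 *\<^sub>R axis i 1)) \<and>
          (\<forall>y\<ge>1. F y = ln y) \<and> normalised_phase i \<Theta>"
    using ln exp_phase_normalised[OF \<Theta> a] by blast
qed

end
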